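(* Let $M$ be a block matroid belonging to the class ${\mathrm{spex}}(\mathrm{LPM})$, with ground set $E$. Then there is a matroid $N$ on $E$ with $N\in{\mathrm{spex}}(\mathrm{LPM})$ whose set of bases is exactly the set of base-cobases of $M$; in particular $G(M,M^\ast)=G(N)$ (equality of graphs).
   Context: A matroid $M=(E,\mathcal{B})$ is given by its set of bases; its dual $M^\ast$ has bases $\{E\setminus B: B\in\mathcal{B}\}$. The base graph $G(M)$ has vertex set $\mathcal{B}$, with $B,B'$ adjacent iff $|B\triangle B'|=2$. $M$ is a block matroid if some base $B$ has $E\setminus B$ also a base; such $B$ is a base-cobase, and $G(M,M^\ast)$ is the subgraph of $G(M)$ induced by the base-cobases. Lattice path matroids (LPM): for nonnegative integers $m,r$, $n=m+r$, let $U,L$ be lattice paths from $(0,0)$ to $(m,r)$ with unit east and north steps, $L$ never above $U$. $M[U,L]$ is the matroid on $[n]$ whose bases are the sets $B\subseteq[n]$ such that the lattice path whose $i$-th step is north iff $i\in B$ stays weakly below $U$ and weakly above $L$. $\mathrm{LPM}$ is the class of all matroids isomorphic to some $M[U,L]$. A matroid $N'$ is a parallel extension of $M'$ if $N'$ has an element $e$ lying in a 2-element circuit of $N'$ with $N'\setminus e=M'$; it is a series extension of $M'$ if $N'$ has an element $e$ lying in a 2-element cocircuit of $N'$ with $N'/e=M'$. For a class $\mathbf{M}$ of matroids, ${\mathrm{spex}}(\mathbf{M})$ is the class of matroids obtained from members of $\mathbf{M}$ by finitely many series and parallel extensions (closure under isomorphism). *)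

theory Defs
  imports Main
begin

section \<open>Matroids\<close>

type_synonym 'a matroid = "'a set \<times> 'a set set"

abbreviation ground :: "'a matroid \<Rightarrow> 'a set" where
  "ground M \<equiv> fst M"

abbreviation bases :: "'a matroid \<Rightarrow> 'a set set" where
  "bases M \<equiv> snd M"

definition matroid :: "'a matroid \<Rightarrow> bool" where
  "matroid M \<longleftrightarrow>
     finite (ground M) \<and> bases M \<noteq> {} \<and> (\<forall>B\<in>bases M. B \<subseteq> ground M) \<and>
     (\<forall>B\<in>bases M. \<forall>B'\<in>bases M. \<forall>x\<in>B - B'. \<exists>y\<in>B' - B. insert y (B - {x}) \<in> bases M)"

definition dual :: "'a matroid \<Rightarrow> 'a matroid" where
  "dual M = (ground M, {ground M - B | B. B \<in> bases M})"

definition indep :: "'a matroid \<Rightarrow> 'a set \<Rightarrow> bool" where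
  "indep M I \<longleftrightarrow> (\<exists>B\<in>bases M. I \<subseteq> B)"

definition circuit :: "'a matroid \<Rightarrow> 'a set \<Rightarrow> bool" where
  "circuit M C \<longleftrightarrow> C \<subseteq> ground M \<and> \<not> indep M C \<and> (\<forall>D. D \<subset> C \<longrightarrow> indep M D)"

definition cocircuit :: "'a matroid \<Rightarrow> 'a set \<Rightarrow> bool" where
  "cocircuit M C \<longleftrightarrow> circuit (dual M) C"

definition maximal_members :: "'a set set \<Rightarrow> 'a set set" where
  "maximal_members S = {A \<in> S. \<forall>A'\<in>S. A \<subseteq> A' \<longrightarrow> A = A'}"

text \<open>Taking maximal members only matters when \<open>e\<close> lies in every base.\<close>

definition delete :: "'a matroid \<Rightarrow> 'a \<Rightarrow> 'a matroid" where
  "delete M e = (ground M - {e}, maximal_members {B - {e} | B. B \<in> bases M})"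

definition contract :: "'a matroid \<Rightarrow> 'a \<Rightarrow> 'a matroid" where
  "contract M e = dual (delete (dual M) e)"

definition matroid_iso :: "'a matroid \<Rightarrow> 'b matroid \<Rightarrow> bool" where
  "matroid_iso M N \<longleftrightarrow>
     (\<exists>f. bij_betw f (ground M) (ground N) \<and>
          (\<forall>B. B \<subseteq> ground M \<longrightarrow> (B \<in> bases M \<longleftrightarrow> f ` B \<in> bases N)))"


section \<open>Series-parallel extensions\<close>

definition parallel_extension :: "'a matroid \<Rightarrow> 'a matroid \<Rightarrow> bool" where
  "parallel_extension N M \<longleftrightarrow>
     matroid N \<and>
     (\<exists>e\<in>ground N. (\<exists>C. circuit N C \<and> card C = 2 \<and> e \<in> C) \<and> delete N e = M)"

definition series_extension :: "'a matroid \<Rightarrow> 'a matroid \<Rightarrow> bool" where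
  "series_extension N M \<longleftrightarrow>
     matroid N \<and>
     (\<exists>e\<in>ground N. (\<exists>C. cocircuit N C \<and> card C = 2 \<and> e \<in> C) \<and> contract N e = M)"

text \<open>
  Fixing the element type loses nothing: an extension only enlarges the ground set, so every
  matroid occurring in a construction of \<open>M\<close> can be placed on a subset of the ground set of \<open>M\<close>.
\<close>

inductive_set spex :: "'a matroid set \<Rightarrow> 'a matroid set" for \<M> :: "'a matroid set" where
  base: "M \<in> \<M> \<Longrightarrow> M \<in> spex \<M>"
| parallel: "M \<in> spex \<M> \<Longrightarrow> parallel_extension N M \<Longrightarrow> N \<in> spex \<M>"
| series: "M \<in> spex \<M> \<Longrightarrow> series_extension N M \<Longrightarrow> N \<in> spex \<M>"
| iso: "M \<in> spex \<M> \<Longrightarrow> matroid N \<Longrightarrow> matroid_iso M N \<Longrightarrow> N \<in> spex \<M>"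


section \<open>Lattice path matroids\<close>

datatype step = East | North

definition lattice_path :: "nat \<Rightarrow> nat \<Rightarrow> step list \<Rightarrow> bool" where
  "lattice_path m r P \<longleftrightarrow> count_list P East = m \<and> count_list P North = r"

definition path_point :: "step list \<Rightarrow> nat \<Rightarrow> nat \<times> nat" where
  "path_point P k = (count_list (take k P) East, count_list (take k P) North)"

definition path_points :: "step list \<Rightarrow> (nat \<times> nat) set" where
  "path_points P = {path_point P k | k. k \<le> length P}"

definition weakly_below :: "step list \<Rightarrow> step list \<Rightarrow> bool" where
  "weakly_below P Q \<longleftrightarrow>
     (\<forall>(x, y)\<in>path_points P. \<exists>y'. (x, y') \<in> path_points Q \<and> y \<le> y')"

definition weakly_above :: "step list \<Rightarrow> step list \<Rightarrow> bool" where
  "weakly_above P Q \<longleftrightarrow>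
     (\<forall>(x, y)\<in>path_points P. \<exists>y'. (x, y') \<in> path_points Q \<and> y' \<le> y)"

definition path_of :: "nat \<Rightarrow> nat set \<Rightarrow> step list" where
  "path_of n B = map (\<lambda>i. if i \<in> B then North else East) [1..<Suc n]"

text \<open>
  For \<open>U\<close> and \<open>L\<close> with a common endpoint, the two bounding conditions force
  the path of \<open>B\<close> to end there as well.
\<close>

definition lattice_path_matroid :: "step list \<Rightarrow> step list \<Rightarrow> nat matroid" where
  "lattice_path_matroid U L =
     (let n = length U in
       ({1..n}, {B. B \<subseteq> {1..n} \<and> weakly_below (path_of n B) U \<and> weakly_above (path_of n B) L}))"

definition LPM :: "'a matroid set" where
  "LPM = {M. matroid M \<and>
     (\<exists>m r U L. lattice_path m r U \<and> lattice_path m r L \<and> weakly_below L U \<and>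
        matroid_iso (lattice_path_matroid U L) M)}"


section \<open>Base-cobases and base graphs\<close>

definition base_cobases :: "'a matroid \<Rightarrow> 'a set set" where
  "base_cobases M = {B \<in> bases M. ground M - B \<in> bases M}"

definition block_matroid :: "'a matroid \<Rightarrow> bool" where
  "block_matroid M \<longleftrightarrow> matroid M \<and> base_cobases M \<noteq> {}"

text \<open>An undirected graph is a pair of a vertex set and a set of two-element edges.\<close>

type_synonym 'v ugraph = "'v set \<times> 'v set set"

definition induced_subgraph :: "'v ugraph \<Rightarrow> 'v set \<Rightarrow> 'v ugraph" where
  "induced_subgraph G W = (fst G \<inter> W, {e \<in> snd G. e \<subseteq> W})"

definition base_graph :: "'a matroid \<Rightarrow> 'a set ugraph" where
  "base_graph M =
     (bases M, {{B, B'} | B B'. B \<in> bases M \<and> B' \<in> bases M \<and> card (sym_diff B B') = 2})"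

definition base_cobase_graph :: "'a matroid \<Rightarrow> 'a set ugraph" where
  "base_cobase_graph M = induced_subgraph (base_graph M) (base_cobases M)"

end

theory Submission
  imports Defs
begin

text \<open>
  A lattice path matroid consists of the sets \<open>B\<close> whose height functions \<open>k \<mapsto> \<bar>B \<inter> [k]\<bar>\<close> satisfy
  \<open>l k \<le> \<bar>B \<inter> [k]\<bar> \<le> u k\<close>. Conversely, arbitrary bounds with equal final values give a lattice path
  matroid as soon as some set satisfies them: the pointwise maximum and minimum of the admissible
  heights are again heights of lattice paths. Complementation replaces the height by \<open>k\<close> minus the
  height, so the base-cobases of a lattice path matroid are again described by such bounds.

  For the other members of the class, induct on the size of the ground set. A matroid and its
  dual have the same base-cobases, so one may assume that \<open>M\<close> has a parallel pair \<open>g, h\<close>. Neither a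
  base nor its complement contains both, so every base-cobase contains exactly one of them, and the
  base-cobases of \<open>M\<close> are those of \<open>M \ g / h\<close> enlarged by \<open>g\<close> or by \<open>h\<close>. Since the class is closed
  under minors and under adding loops and coloops, the induction hypothesis applies to \<open>M \ g / h\<close>,
  and a coloop \<open>h\<close> followed by a parallel extension by \<open>g\<close> gives the required matroid.
\<close>

section \<open>Matroid basics\<close>

lemma matroidD:
  assumes "matroid M"
  shows "finite (ground M)" "bases M \<noteq> {}" "\<And>B. B \<in> bases M \<Longrightarrow> B \<subseteq> ground M"
    "\<And>B B' x. B \<in> bases M \<Longrightarrow> B' \<in> bases M \<Longrightarrow> x \<in> B \<Longrightarrow> x \<notin> B' \<Longrightarrow>
       \<exists>y. y \<in> B' \<and> y \<notin> B \<and> insert y (B - {x}) \<in> bases M"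
  using assms unfolding matroid_def by blast+

lemma matroidI:
  assumes "finite (ground M)" "bases M \<noteq> {}" "\<And>B. B \<in> bases M \<Longrightarrow> B \<subseteq> ground M"
    "\<And>B B' x. B \<in> bases M \<Longrightarrow> B' \<in> bases M \<Longrightarrow> x \<in> B \<Longrightarrow> x \<notin> B' \<Longrightarrow>
       \<exists>y. y \<in> B' \<and> y \<notin> B \<and> insert y (B - {x}) \<in> bases M"
  shows "matroid M"
  using assms unfolding matroid_def by (metis DiffD1 DiffD2 DiffI)

lemma bases_antichain:
  assumes "matroid M" "B \<in> bases M" "B' \<in> bases M" "B \<subseteq> B'"
  shows "B = B'"
  using matroidD(4)[OF assms(1) assms(3) assms(2)] assms(4) by blast

text \<open>Exchange that prescribes the incoming element instead of the outgoing one; it is the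
  exchange axiom of the dual. If \<open>x\<close> is all of \<open>B' - B\<close>, then removing
  from \<open>B\<close> any element outside \<open>B'\<close> can only bring in \<open>x\<close>.
  Otherwise exchanging some other \<open>z\<close> of \<open>B' - B\<close> out of \<open>B'\<close>
  keeps \<open>x\<close> and moves \<open>B'\<close> closer to \<open>B\<close>.\<close>

lemma cobase_exchange:
  assumes M: "matroid M" and B: "B \<in> bases M"
  shows "B' \<in> bases M \<Longrightarrow> x \<in> B' \<Longrightarrow> x \<notin> B \<Longrightarrow>
    \<exists>y. y \<in> B \<and> y \<notin> B' \<and> insert x (B - {y}) \<in> bases M"
proof (induction "card (B' - B)" arbitrary: B' rule: less_induct)
  case less
  have fin: "finite B'"
    using matroidD(1,3)[OF M] less.prems(1) finite_subset by metis
  show ?case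
  proof (cases "B' - B = {x}")
    case True
    obtain y where y: "y \<in> B" "y \<notin> B'"
      using bases_antichain[OF M B less.prems(1)] less.prems by blast
    obtain z where z: "z \<in> B'" "z \<notin> B" "insert z (B - {y}) \<in> bases M"
      using matroidD(4)[OF M B less.prems(1) y] by blast
    have "z = x" using True z(1,2) by blast
    with y z show ?thesis by metis
  next
    case False
    then obtain z where z: "z \<in> B'" "z \<notin> B" "z \<noteq> x"
      using less.prems by blast
    obtain w where w: "w \<in> B" "w \<notin> B'" "insert w (B' - {z}) \<in> bases M"
      using matroidD(4)[OF M less.prems(1) B z(1,2)] by blast
    have "insert w (B' - {z}) - B = (B' - B) - {z}" "z \<in> B' - B"
      using w(1) z by auto
    then have card: "card (insert w (B' - {z}) - B) < card (B' - B)"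
      using fin card_Diff1_less[of "B' - B" z] by simp
    have "x \<in> insert w (B' - {z})" using less.prems z by simp
    then obtain y where y: "y \<in> B" "y \<notin> insert w (B' - {z})" "insert x (B - {y}) \<in> bases M"
      using less.hyps[OF card w(3) _ less.prems(3)] by metis
    have "y \<notin> B'" using y(1,2) z(2) by auto
    with y show ?thesis by metis
  qed
qed

section \<open>Duality\<close>

lemma ground_dual [simp]: "ground (dual M) = ground M"
  by (simp add: dual_def)

lemma bases_dual: "bases (dual M) = (\<lambda>B. ground M - B) ` bases M"
  by (auto simp: dual_def)

lemma dual_dual:
  assumes "\<And>B. B \<in> bases M \<Longrightarrow> B \<subseteq> ground M"
  shows "dual (dual M) = M"
proof (rule prod_eqI)
  have "(\<lambda>B. ground M - (ground M - B)) ` bases M = id ` bases M"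
    using assms by (intro image_cong) auto
  then show "bases (dual (dual M)) = bases M"
    by (simp add: bases_dual image_image)
qed simp

lemma matroid_dual:
  assumes "matroid M"
  shows "matroid (dual M)"
proof (rule matroidI)
  fix B B' x
  assume "B \<in> bases (dual M)" "B' \<in> bases (dual M)" and x: "x \<in> B" "x \<notin> B'"
  then obtain A A' where A: "A \<in> bases M" "A' \<in> bases M" "B = ground M - A" "B' = ground M - A'"
    by (auto simp: bases_dual)
  then obtain y where y: "y \<in> A" "y \<notin> A'" "insert x (A - {y}) \<in> bases M"
    using cobase_exchange[OF assms A(1,2), of x] x by blast
  have "y \<in> ground M" using y A matroidD(3)[OF assms] by blast
  then have "insert y (B - {x}) = ground M - insert x (A - {y})"
    using A x y by blast
  then show "\<exists>y. y \<in> B' \<and> y \<notin> B \<and> insert y (B - {x}) \<in> bases (dual M)"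
    using y A \<open>y \<in> ground M\<close> by (auto simp: bases_dual)
qed (use matroidD[OF assms] in \<open>auto simp: bases_dual\<close>)

lemma base_cobases_dual:
  assumes "matroid M"
  shows "base_cobases (dual M) = base_cobases M"
proof -
  have eq: "B \<in> bases (dual M) \<longleftrightarrow> ground M - B \<in> bases M" if "B \<subseteq> ground M" for B
  proof
    assume "B \<in> bases (dual M)"
    then show "ground M - B \<in> bases M"
      using matroidD(3)[OF assms] by (auto simp: bases_dual double_diff)
  next
    assume "ground M - B \<in> bases M"
    then show "B \<in> bases (dual M)"
      using that by (auto simp: bases_dual double_diff intro!: rev_image_eqI)
  qed
  show ?thesis
    using eq matroidD(3)[OF assms] matroidD(3)[OF matroid_dual[OF assms]]
    by (auto simp: base_cobases_def double_diff)
qed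

text \<open>A base of one matroid lies in a base of the other, which lies in a base of the first;
  since bases form an antichain, all three coincide. This makes commutation of minors a computation
  with independent sets.\<close>

lemma matroid_eqI:
  assumes "matroid M" "matroid N" "ground M = ground N" "\<And>I. indep M I \<longleftrightarrow> indep N I"
  shows "M = N"
proof (rule prod_eqI)
  have "bases M \<subseteq> bases N" if M: "matroid M" and eq: "\<And>I. indep M I \<longleftrightarrow> indep N I"
    for M N :: "'a matroid"
  proof
    fix B assume B: "B \<in> bases M"
    then have "indep N B" unfolding eq[symmetric] by (auto simp: indep_def)
    then obtain C where C: "C \<in> bases N" "B \<subseteq> C" by (auto simp: indep_def)
    then have "indep M C" unfolding eq by (auto simp: indep_def)
    then obtain D where D: "D \<in> bases M" "C \<subseteq> D" by (auto simp: indep_def)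
    then have "B = D" using bases_antichain[OF M B] C by blast
    then show "B \<in> bases N" using C D by auto
  qed
  then show "bases M = bases N" using assms by blast
qed (rule assms)

section \<open>Deletion and contraction\<close>

lemma ground_delete [simp]: "ground (delete M e) = ground M - {e}"
  by (simp add: delete_def)

lemma ground_contract [simp]: "ground (contract M e) = ground M - {e}"
  by (simp add: contract_def)

lemma bases_delete:
  assumes M: "matroid M" and B0: "B0 \<in> bases M" "e \<notin> B0"
  shows "bases (delete M e) = {B \<in> bases M. e \<notin> B}"
proof (intro subset_antisym subsetI)
  fix A assume "A \<in> bases (delete M e)"
  then obtain B where B: "B \<in> bases M" "A = B - {e}"
    and max: "\<And>B'. B' \<in> bases M \<Longrightarrow> A \<subseteq> B' - {e} \<Longrightarrow> A = B' - {e}"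
    by (auto simp: delete_def maximal_members_def)
  \<comment> \<open>If \<open>e\<close> were in \<open>B\<close>, exchanging it for an element of
    \<open>B0\<close> would give a base whose trace properly contains \<open>B - {e}\<close>,
    against maximality.\<close>
  have "e \<notin> B"
  proof
    assume e: "e \<in> B"
    then obtain y where y: "y \<in> B0" "y \<notin> B" "insert y (B - {e}) \<in> bases M"
      using matroidD(4)[OF M B(1) B0(1)] B0(2) by blast
    then show False using max[OF y(3)] B B0 by blast
  qed
  then show "A \<in> {B \<in> bases M. e \<notin> B}" using B by simp
next
  fix B assume "B \<in> {B \<in> bases M. e \<notin> B}"
  then have B: "B \<in> bases M" "e \<notin> B" by auto
  have "B = B' - {e}" if "B' \<in> bases M" "B \<subseteq> B' - {e}" for B'
    using bases_antichain[OF M B(1) that(1)] that(2) by blast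
  then show "B \<in> bases (delete M e)"
    using B by (auto simp: delete_def maximal_members_def intro!: exI[of _ B])
qed

lemma bases_delete_coloop:
  assumes M: "matroid M" and e: "\<And>B. B \<in> bases M \<Longrightarrow> e \<in> B"
  shows "bases (delete M e) = (\<lambda>B. B - {e}) ` bases M"
proof -
  have "B - {e} = B' - {e}" if "B \<in> bases M" "B' \<in> bases M" "B - {e} \<subseteq> B' - {e}" for B B'
    using bases_antichain[OF M that(1,2)] that e by blast
  then show ?thesis
    by (auto simp: delete_def maximal_members_def)
qed

lemma matroid_delete:
  assumes M: "matroid M"
  shows "matroid (delete M e)"
proof (cases "\<exists>B0\<in>bases M. e \<notin> B0")
  case True
  then obtain B0 where "B0 \<in> bases M" "e \<notin> B0" by blast
  note b = bases_delete[OF M this]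
  show ?thesis
  proof (rule matroidI)
    fix B B' x
    assume "B \<in> bases (delete M e)" "B' \<in> bases (delete M e)" "x \<in> B" "x \<notin> B'"
    then show "\<exists>y. y \<in> B' \<and> y \<notin> B \<and> insert y (B - {x}) \<in> bases (delete M e)"
      using matroidD(4)[OF M, of B B' x] by (auto simp: b)
  qed (use True matroidD[OF M] in \<open>auto simp: b\<close>)
next
  case False
  then have e: "\<And>B. B \<in> bases M \<Longrightarrow> e \<in> B" by blast
  note b = bases_delete_coloop[OF M e]
  show ?thesis
  proof (rule matroidI)
    fix A A' x
    assume "A \<in> bases (delete M e)" "A' \<in> bases (delete M e)" and x: "x \<in> A" "x \<notin> A'"
    then obtain B B' where B: "B \<in> bases M" "B' \<in> bases M" "A = B - {e}" "A' = B' - {e}"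
      by (auto simp: b)
    then obtain y where y: "y \<in> B'" "y \<notin> B" "insert y (B - {x}) \<in> bases M"
      using matroidD(4)[OF M B(1,2)] x by blast
    have "y \<noteq> e" using e B y by blast
    then have "insert y (A - {x}) = insert y (B - {x}) - {e}" using B by blast
    then show "\<exists>y. y \<in> A' \<and> y \<notin> A \<and> insert y (A - {x}) \<in> bases (delete M e)"
      using y B \<open>y \<noteq> e\<close> by (auto simp: b)
  qed (use matroidD[OF M] in \<open>auto simp: b\<close>)
qed

lemma matroid_contract: "matroid M \<Longrightarrow> matroid (contract M e)"
  by (simp add: contract_def matroid_dual matroid_delete)

lemma indep_delete:
  assumes M: "matroid M"
  shows "indep (delete M e) I \<longleftrightarrow> indep M I \<and> e \<notin> I"
proof (cases "\<exists>B0\<in>bases M. e \<notin> B0")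
  case True
  then obtain B0 where B0: "B0 \<in> bases M" "e \<notin> B0" by blast
  \<comment> \<open>A base through \<open>e\<close> that contains \<open>I\<close> is moved off
    \<open>e\<close> by an exchange towards \<open>B0\<close>; \<open>I\<close> survives because it
    avoids \<open>e\<close>.\<close>
  have "\<exists>B\<in>bases M. e \<notin> B \<and> I \<subseteq> B" if I: "B \<in> bases M" "I \<subseteq> B" "e \<notin> I" for B
  proof (cases "e \<in> B")
    case True
    then obtain y where y: "y \<in> B0" "insert y (B - {e}) \<in> bases M"
      using matroidD(4)[OF M I(1) B0(1)] B0(2) by blast
    have "e \<notin> insert y (B - {e})" "I \<subseteq> insert y (B - {e})" using I B0 y(1) by auto
    with y(2) show ?thesis by metis
  qed (use I in blast)
  then show ?thesis
    unfolding indep_def bases_delete[OF M B0] by blast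
next
  case False
  then show ?thesis
    using bases_delete_coloop[OF M, of e] by (auto simp: indep_def)
qed

lemma delete_dual:
  assumes "matroid M"
  shows "delete (dual M) e = dual (contract M e)"
  using matroidD(3)[OF matroid_delete[OF matroid_dual[OF assms]]]
  by (simp add: contract_def dual_dual)

lemma contract_dual:
  assumes "matroid M"
  shows "contract (dual M) e = dual (delete M e)"
  by (simp add: contract_def dual_dual matroidD(3)[OF assms])

text \<open>Independence of \<open>{e}\<close> provides a base through \<open>e\<close>, whose
  complement is a base of the dual avoiding \<open>e\<close>. Hence deletion in the dual simply
  selects the bases avoiding \<open>e\<close>, and complementing turns these into the bases of
  \<open>M\<close> through \<open>e\<close>.\<close>

lemma bases_contract:
  assumes M: "matroid M" and e: "indep M {e}"
  shows "bases (contract M e) = {B - {e} | B. B \<in> bases M \<and> e \<in> B}"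
proof -
  obtain B0 where "B0 \<in> bases M" "e \<in> B0" using e by (auto simp: indep_def)
  then have B0: "ground M - B0 \<in> bases (dual M)" "e \<notin> ground M - B0" "e \<in> ground M"
    using matroidD(3)[OF M] by (auto simp: bases_dual)
  have *: "(ground M - {e}) - (ground M - B) = B - {e}" if "B \<in> bases M" for B
    using matroidD(3)[OF M that] by blast
  have "bases (contract M e) = (\<lambda>B. (ground M - {e}) - B) ` {B \<in> bases (dual M). e \<notin> B}"
    by (simp add: contract_def bases_dual[of "delete (dual M) e"]
        bases_delete[OF matroid_dual[OF M] B0(1,2)])
  also have "\<dots> = (\<lambda>B. (ground M - {e}) - (ground M - B)) ` {B \<in> bases M. e \<in> B}"
    using B0(3) by (auto simp: bases_dual)
  also have "\<dots> = (\<lambda>B. B - {e}) ` {B \<in> bases M. e \<in> B}"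
    by (intro image_cong) (auto simp: *)
  finally show ?thesis by auto
qed

lemma indep_contract:
  assumes "matroid M" "indep M {e}"
  shows "indep (contract M e) I \<longleftrightarrow> indep M (insert e I) \<and> e \<notin> I"
  by (auto simp: indep_def bases_contract[OF assms])

text \<open>A loop is a coloop of the dual; stripping it from every base there and complementing
  back returns the bases of \<open>M\<close>, all of which already avoid \<open>e\<close>.\<close>

lemma contract_loop:
  assumes M: "matroid M" and e: "e \<in> ground M" "\<not> indep M {e}"
  shows "contract M e = delete M e"
proof (rule prod_eqI)
  have nin: "e \<notin> B" if "B \<in> bases M" for B using that e by (auto simp: indep_def)
  have coloop: "e \<in> B" if "B \<in> bases (dual M)" for B
    using that e nin by (auto simp: bases_dual)
  obtain B0 where B0: "B0 \<in> bases M" using matroidD(2)[OF M] by blast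
  have *: "(ground M - {e}) - (ground M - B - {e}) = B" if "B \<in> bases M" for B
    using matroidD(3)[OF M that] nin[OF that] by blast
  have "bases (contract M e) = (\<lambda>B. (ground M - {e}) - (ground M - B - {e})) ` bases M"
    using bases_delete_coloop[OF matroid_dual[OF M] coloop]
    by (simp add: contract_def bases_dual image_image)
  also have "\<dots> = id ` bases M"
    by (intro image_cong) (auto simp: *)
  also have "\<dots> = bases (delete M e)"
    using nin bases_delete[OF M B0 nin[OF B0]] by auto
  finally show "bases (contract M e) = bases (delete M e)" .
qed simp

section \<open>Images, loops and coloops\<close>

text \<open>Transport of structure: with it an isomorphism becomes an equation between matroids, see
  \<open>matroid_iso_iff_image\<close>.\<close>

definition matroid_image :: "('a \<Rightarrow> 'b) \<Rightarrow> 'a matroid \<Rightarrow> 'b matroid" where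
  "matroid_image f M = (f ` ground M, (`) f ` bases M)"

lemma ground_matroid_image [simp]: "ground (matroid_image f M) = f ` ground M"
  and bases_matroid_image [simp]: "bases (matroid_image f M) = (`) f ` bases M"
  by (simp_all add: matroid_image_def)

lemma matroid_matroid_image:
  assumes M: "matroid M" and f: "inj_on f (ground M)"
  shows "matroid (matroid_image f M)"
proof (rule matroidI)
  fix A A' x
  assume "A \<in> bases (matroid_image f M)" "A' \<in> bases (matroid_image f M)" "x \<in> A" "x \<notin> A'"
  then obtain B B' z where B: "B \<in> bases M" "B' \<in> bases M" "A = f ` B" "A' = f ` B'"
    and z: "z \<in> B" "z \<notin> B'" "x = f z"
    by auto
  then obtain y where y: "y \<in> B'" "y \<notin> B" "insert y (B - {z}) \<in> bases M"
    using matroidD(4)[OF M B(1,2) z(1,2)] by blast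
  have sub: "B \<subseteq> ground M" "B' \<subseteq> ground M" using B matroidD(3)[OF M] by auto
  have "f ` (B - {z}) = A - {x}"
    using inj_on_image_set_diff[OF f, of B "{z}"] sub z B by auto
  then have "f ` insert y (B - {z}) = insert (f y) (A - {x})"
    by simp
  moreover have "f y \<notin> A"
    using inj_on_image_mem_iff[OF f, of y B] sub y B by auto
  ultimately show "\<exists>y. y \<in> A' \<and> y \<notin> A \<and> insert y (A - {x}) \<in> bases (matroid_image f M)"
    using y B by (metis bases_matroid_image imageI)
qed (use matroidD(1-3)[OF M] in \<open>auto simp: image_mono\<close>)

lemma matroid_iso_iff_image:
  assumes "matroid M" "matroid N"
  shows "matroid_iso M N \<longleftrightarrow> (\<exists>f. inj_on f (ground M) \<and> N = matroid_image f M)"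
proof
  assume "matroid_iso M N"
  then obtain f where f: "bij_betw f (ground M) (ground N)"
    and B: "\<And>B. B \<subseteq> ground M \<Longrightarrow> B \<in> bases M \<longleftrightarrow> f ` B \<in> bases N"
    by (auto simp: matroid_iso_def)
  have "bases N = (`) f ` bases M"
  proof (intro subset_antisym subsetI)
    fix A assume A: "A \<in> bases N"
    then have "A \<subseteq> f ` ground M"
      using matroidD(3)[OF assms(2)] f by (simp add: bij_betw_def)
    then obtain C where "C \<subseteq> ground M" "A = f ` C" by (meson subset_imageE)
    then show "A \<in> (`) f ` bases M" using A B by blast
  qed (use B matroidD(3)[OF assms(1)] in blast)
  then have "N = matroid_image f M"
    using f by (intro prod_eqI) (auto simp: bij_betw_def)
  then show "\<exists>f. inj_on f (ground M) \<and> N = matroid_image f M"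
    using f bij_betw_def by blast
next
  assume "\<exists>f. inj_on f (ground M) \<and> N = matroid_image f M"
  then obtain f where f: "inj_on f (ground M)" "N = matroid_image f M" by blast
  have "B \<in> bases M" if "f ` B = f ` B'" "B \<subseteq> ground M" "B' \<in> bases M" for B B'
    using inj_on_image_eq_iff[OF f(1), of B B'] that matroidD(3)[OF assms(1)] by blast
  then show "matroid_iso M N"
    using f by (auto simp: matroid_iso_def bij_betw_def intro!: exI[of _ f])
qed

lemma dual_matroid_image:
  assumes M: "matroid M" and f: "inj_on f (ground M)"
  shows "dual (matroid_image f M) = matroid_image f (dual M)"
proof (rule prod_eqI)
  have "(\<lambda>B. f ` ground M - f ` B) ` bases M = (\<lambda>B. f ` (ground M - B)) ` bases M"
    using inj_on_image_set_diff[OF f] matroidD(3)[OF M] by (intro image_cong) auto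
  then show "bases (dual (matroid_image f M)) = bases (matroid_image f (dual M))"
    by (simp add: bases_dual image_image)
qed simp

lemma indep_matroid_image:
  assumes M: "matroid M" and f: "inj_on f (ground M)" and I: "I \<subseteq> ground M"
  shows "indep (matroid_image f M) (f ` I) \<longleftrightarrow> indep M I"
proof -
  have "f ` I \<subseteq> f ` B \<longleftrightarrow> I \<subseteq> B" if "B \<in> bases M" for B
    using inj_on_image_mem_iff[OF f _ matroidD(3)[OF M that]] I by blast
  then show ?thesis by (auto simp: indep_def)
qed

text \<open>The base \<open>B0\<close> keeps \<open>e\<close> from being a coloop, so on both sides
  deletion just selects the bases that avoid the element.\<close>

lemma delete_matroid_image:
  assumes M: "matroid M" and f: "inj_on f (ground M)" and e: "e \<in> ground M"
    and B0: "B0 \<in> bases M" "e \<notin> B0"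
  shows "delete (matroid_image f M) (f e) = matroid_image f (delete M e)"
proof (rule prod_eqI)
  have mem: "f e \<in> f ` B \<longleftrightarrow> e \<in> B" if "B \<in> bases M" for B
    using inj_on_image_mem_iff[OF f e matroidD(3)[OF M that]] .
  have "bases (delete (matroid_image f M) (f e)) = {A \<in> (`) f ` bases M. f e \<notin> A}"
    using bases_delete[OF matroid_matroid_image[OF M f], of "f ` B0" "f e"] B0 mem by simp
  also have "\<dots> = (`) f ` {B \<in> bases M. e \<notin> B}"
    using mem by blast
  finally show "bases (delete (matroid_image f M) (f e)) = bases (matroid_image f (delete M e))"
    by (simp add: bases_delete[OF M B0])
  show "ground (delete (matroid_image f M) (f e)) = ground (matroid_image f (delete M e))"
    using inj_on_image_set_diff[OF f, of "ground M" "{e}"] e by auto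
qed

section \<open>Adjoining a loop or a coloop\<close>

definition add_loop :: "'a \<Rightarrow> 'a matroid \<Rightarrow> 'a matroid" where
  "add_loop e M = (insert e (ground M), bases M)"

definition add_coloop :: "'a \<Rightarrow> 'a matroid \<Rightarrow> 'a matroid" where
  "add_coloop e M = (insert e (ground M), insert e ` bases M)"

lemma ground_add_loop [simp]: "ground (add_loop e M) = insert e (ground M)"
  and bases_add_loop [simp]: "bases (add_loop e M) = bases M"
  and ground_add_coloop [simp]: "ground (add_coloop e M) = insert e (ground M)"
  and bases_add_coloop [simp]: "bases (add_coloop e M) = insert e ` bases M"
  by (simp_all add: add_loop_def add_coloop_def)

lemma dual_add_loop:
  assumes "matroid M" "e \<notin> ground M"
  shows "dual (add_loop e M) = add_coloop e (dual M)"
proof (rule prod_eqI)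
  have "(\<lambda>B. insert e (ground M) - B) ` bases M = (\<lambda>B. insert e (ground M - B)) ` bases M"
    using assms matroidD(3)[OF assms(1)] by (intro image_cong) auto
  then show "bases (dual (add_loop e M)) = bases (add_coloop e (dual M))"
    by (simp add: bases_dual image_image)
qed simp

lemma dual_add_coloop:
  assumes "matroid M" "e \<notin> ground M"
  shows "dual (add_coloop e M) = add_loop e (dual M)"
proof (rule prod_eqI)
  have "(\<lambda>B. insert e (ground M) - insert e B) ` bases M = (\<lambda>B. ground M - B) ` bases M"
    using assms matroidD(3)[OF assms(1)] by (intro image_cong) auto
  then show "bases (dual (add_coloop e M)) = bases (add_loop e (dual M))"
    by (simp add: bases_dual image_image)
qed simp

lemma matroid_add_loop: "matroid M \<Longrightarrow> matroid (add_loop e M)"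
  unfolding matroid_def by auto

lemma matroid_add_coloop:
  assumes "matroid M" "e \<notin> ground M"
  shows "matroid (add_coloop e M)"
  using dual_add_loop[OF matroid_dual[OF assms(1)], of e] assms
    matroid_dual[OF matroid_add_loop[OF matroid_dual[OF assms(1)], of e]]
  by (simp add: dual_dual matroidD(3))

section \<open>Parallel pairs\<close>

text \<open>These are the two-element circuits (\<open>circuit_card_2\<close>), phrased through
  \<open>indep\<close> so that the rules for independence in minors and images apply
  directly.\<close>

definition parallel_pair :: "'a matroid \<Rightarrow> 'a \<Rightarrow> 'a \<Rightarrow> bool" where
  "parallel_pair M g h \<longleftrightarrow> g \<noteq> h \<and> indep M {g} \<and> indep M {h} \<and> \<not> indep M {g, h}"

lemma parallel_pair_sym: "parallel_pair M g h \<Longrightarrow> parallel_pair M h g"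
  by (auto simp: parallel_pair_def insert_commute)

lemma parallel_pair_ground:
  assumes "matroid M" "parallel_pair M g h"
  shows "g \<in> ground M" "h \<in> ground M"
  using assms(2) matroidD(3)[OF assms(1)] by (auto simp: parallel_pair_def indep_def)

lemma parallel_pair_not_both:
  "parallel_pair M g h \<Longrightarrow> B \<in> bases M \<Longrightarrow> g \<in> B \<Longrightarrow> h \<notin> B"
  by (auto simp: parallel_pair_def indep_def)

lemma parallel_pair_noncoloop:
  assumes "parallel_pair M g h"
  obtains B where "B \<in> bases M" "g \<notin> B" "h \<in> B"
  using assms by (auto simp: parallel_pair_def indep_def)

text \<open>Bring \<open>h\<close> into \<open>B\<close> by \<open>cobase_exchange\<close>. The
  element that leaves must be \<open>g\<close>, since no base contains both.\<close>

lemma parallel_pair_swap: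
  assumes M: "matroid M" and p: "parallel_pair M g h" and B: "B \<in> bases M" "g \<in> B"
  shows "insert h (B - {g}) \<in> bases M"
proof -
  obtain B' where B': "B' \<in> bases M" "h \<in> B'" using parallel_pair_noncoloop[OF p] by metis
  have "h \<notin> B" using parallel_pair_not_both[OF p B] .
  then obtain y where y: "y \<in> B" "insert h (B - {y}) \<in> bases M"
    using cobase_exchange[OF M B(1) B'] by blast
  then have "y = g" using parallel_pair_not_both[OF p y(2)] B by blast
  then show ?thesis using y by simp
qed

lemma circuit_card_2:
  assumes M: "matroid M"
  shows "circuit M C \<and> card C = 2 \<and> g \<in> C \<longleftrightarrow> (\<exists>h. C = {g, h} \<and> parallel_pair M g h)"
    (is "?L \<longleftrightarrow> ?R")
proof
  assume L: ?L
  then obtain h where "C = {g, h}" "g \<noteq> h" unfolding card_2_iff by blast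
  moreover from this have "{g} \<subset> C" "{h} \<subset> C" by auto
  ultimately show ?R using L unfolding circuit_def parallel_pair_def by metis
next
  assume ?R
  then obtain h where h: "C = {g, h}" and p: "parallel_pair M g h" by blast
  have "D = {} \<or> D = {g} \<or> D = {h}" if "D \<subset> {g, h}" for D using that by auto
  moreover have "indep M {}" using p by (auto simp: parallel_pair_def indep_def)
  ultimately show ?L
    using p h parallel_pair_ground[OF M p] by (auto simp: circuit_def parallel_pair_def)
qed

lemma parallel_extension_iff:
  "parallel_extension N M \<longleftrightarrow> matroid N \<and> (\<exists>g h. parallel_pair N g h \<and> delete N g = M)"
  unfolding parallel_extension_def
  using circuit_card_2[of N] parallel_pair_ground[of N] by metis

lemma series_extension_iff:
  assumes "matroid N"
  shows "series_extension N M \<longleftrightarrow> (\<exists>g h. parallel_pair (dual N) g h \<and> contract N g = M)"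
  unfolding series_extension_def cocircuit_def
  using circuit_card_2[OF matroid_dual[OF assms]] parallel_pair_ground[OF matroid_dual[OF assms]]
    assms by (metis ground_dual)

section \<open>Lattice path matroids as interval systems\<close>

definition height :: "'a list \<Rightarrow> 'a set \<Rightarrow> nat \<Rightarrow> nat" where
  "height xs B k = card (B \<inter> set (take k xs))"

text \<open>The bounds are arbitrary integer functions, not heights of paths, so that they can be
  reflected, intersected and shifted freely. The list \<open>xs\<close> carries both the ground set
  and the order of its elements along the path.\<close>

definition interval_system :: "'a list \<Rightarrow> (nat \<Rightarrow> int) \<Rightarrow> (nat \<Rightarrow> int) \<Rightarrow> 'a matroid" where
  "interval_system xs l u =
     (set xs, {B. B \<subseteq> set xs \<and> (\<forall>k\<le>length xs. l k \<le> int (height xs B k) \<and> int (height xs B k) \<le> u k)})"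

lemma ground_interval_system [simp]: "ground (interval_system xs l u) = set xs"
  by (simp add: interval_system_def)

lemma mem_bases_interval_system:
  "B \<in> bases (interval_system xs l u) \<longleftrightarrow>
     B \<subseteq> set xs \<and> (\<forall>k\<le>length xs. l k \<le> int (height xs B k) \<and> int (height xs B k) \<le> u k)"
  by (simp add: interval_system_def)

lemma height_0 [simp]: "height xs B 0 = 0"
  by (simp add: height_def)

lemma height_Suc:
  assumes "distinct xs" "k < length xs"
  shows "height xs B (Suc k) = height xs B k + (if xs ! k \<in> B then 1 else 0)"
proof -
  have "xs ! k \<notin> set (take k xs)"
    using assms by (auto simp: in_set_conv_nth nth_eq_iff_index_eq)
  then show ?thesis
    using assms(2) by (simp add: height_def take_Suc_conv_app_nth)
qed

lemma height_exchange:
  assumes xs: "distinct xs" "p < length xs" "q < length xs" and pq: "xs ! p \<in> B" "xs ! q \<notin> B"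
    and k: "k \<le> length xs"
  shows "int (height xs (insert (xs ! q) (B - {xs ! p})) k) =
    int (height xs B k) - (if p < k then 1 else 0) + (if q < k then 1 else 0)"
  using k
proof (induction k)
  case (Suc k)
  have "xs ! k = xs ! p \<longleftrightarrow> k = p" "xs ! k = xs ! q \<longleftrightarrow> k = q"
    using xs Suc.prems by (simp_all add: nth_eq_iff_index_eq)
  moreover have "p \<noteq> q" using pq by auto
  ultimately show ?case
    using Suc pq by (auto simp: height_Suc[OF xs(1)])
qed simp

text \<open>
  If the path of \<open>B\<close> is above that of \<open>B'\<close> just after the step \<open>x\<close>, then exchange \<open>x\<close> with the
  step of \<open>B'\<close> at which the two paths next meet; otherwise use the last meeting point before \<open>x\<close>.
\<close>

lemma matroid_interval_system:
  assumes xs: "distinct xs" and ne: "bases (interval_system xs l u) \<noteq> {}"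
    and n: "u (length xs) \<le> l (length xs)"
  shows "matroid (interval_system xs l u)"
proof (rule matroidI)
  fix B B' x
  assume B: "B \<in> bases (interval_system xs l u)" and B': "B' \<in> bases (interval_system xs l u)"
    and x: "x \<in> B" "x \<notin> B'"
  define d where "d k = int (height xs B k) - int (height xs B' k)" for k
  have sub: "B \<subseteq> set xs" "B' \<subseteq> set xs"
    and bnd: "\<And>k. k \<le> length xs \<Longrightarrow> l k \<le> int (height xs B k) \<and> int (height xs B k) \<le> u k"
    and bnd': "\<And>k. k \<le> length xs \<Longrightarrow> l k \<le> int (height xs B' k) \<and> int (height xs B' k) \<le> u k"
    using B B' by (auto simp: mem_bases_interval_system)
  obtain p where p: "p < length xs" "xs ! p = x"
    using sub x by (metis in_set_conv_nth subsetD)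
  have d_Suc: "d (Suc k) = d k + (if xs ! k \<in> B then 1 else 0) - (if xs ! k \<in> B' then 1 else 0)"
    if "k < length xs" for k
    using that by (simp add: d_def height_Suc[OF xs])
  have d0: "d 0 = 0" by (simp add: d_def)
  \<comment> \<open>The final bounds satisfy \<open>u <= l\<close>, so they pin down the final
    height, and the two paths end together.\<close>
  have dn: "d (length xs) = 0"
    using bnd[of "length xs"] bnd'[of "length xs"] n by (simp add: d_def)
  have dp: "d (Suc p) = d p + 1" using d_Suc[OF p(1)] p x by simp
  \<comment> \<open>The exchange moves heights by one only between the two positions. There the path
    of \<open>B\<close> lies strictly on one side of that of \<open>B'\<close> and is moved towards
    it, so it stays within bounds that both paths satisfy.\<close>
  have exch: "insert (xs ! q) (B - {x}) \<in> bases (interval_system xs l u)"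
    if q: "q < length xs" "xs ! q \<notin> B"
      and le: "\<And>k. p < k \<Longrightarrow> k \<le> q \<Longrightarrow> d k \<ge> 1" "\<And>k. q < k \<Longrightarrow> k \<le> p \<Longrightarrow> d k \<le> -1" for q
  proof -
    have "l k \<le> int (height xs (insert (xs ! q) (B - {x})) k) \<and>
        int (height xs (insert (xs ! q) (B - {x})) k) \<le> u k" if k: "k \<le> length xs" for k
      using bnd[OF k] bnd'[OF k] le[of k] height_exchange[OF xs p(1) q(1) _ q(2) k] p x
      by (auto simp: d_def not_less)
    then show ?thesis
      using sub q by (auto simp: mem_bases_interval_system)
  qed
  show "\<exists>y. y \<in> B' \<and> y \<notin> B \<and> insert y (B - {x}) \<in> bases (interval_system xs l u)"
  proof (cases "d (Suc p) \<ge> 1")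
    case True
    define K where "K = (LEAST k. k \<ge> Suc p \<and> d k \<le> 0)"
    have ex: "Suc p \<le> length xs \<and> d (length xs) \<le> 0" using p dn by simp
    have K: "K \<ge> Suc p" "d K \<le> 0" "K \<le> length xs"
      unfolding K_def
      using LeastI[of "\<lambda>k. k \<ge> Suc p \<and> d k \<le> 0", OF ex]
        Least_le[of "\<lambda>k. k \<ge> Suc p \<and> d k \<le> 0", OF ex] by auto
    have least: "d k \<ge> 1" if "Suc p \<le> k" "k < K" for k
      using not_less_Least[of k "\<lambda>k. k \<ge> Suc p \<and> d k \<le> 0"] that by (simp add: K_def)
    have "K \<noteq> Suc p" using K True by auto
    then obtain q where q: "K = Suc q" "Suc p \<le> q" using K by (cases K) auto
    have "d q \<ge> 1" using least[of q] q by simp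
    then have "xs ! q \<in> B'" "xs ! q \<notin> B"
      using d_Suc[of q] K q by (auto split: if_splits)
    then show ?thesis
      using exch[of q] least K q by (intro exI[of _ "xs ! q"]) auto
  next
    case False
    then have dp1: "d p \<le> -1" using dp by simp
    define q where "q = (GREATEST k. k \<le> p \<and> d k \<ge> 0)"
    have q: "q \<le> p" "d q \<ge> 0"
      unfolding q_def using GreatestI_nat[of "\<lambda>k. k \<le> p \<and> d k \<ge> 0" 0 p] d0 by auto
    have great: "d k \<le> -1" if "q < k" "k \<le> p" for k
      using Greatest_le_nat[of "\<lambda>k. k \<le> p \<and> d k \<ge> 0" k p] that by (force simp: q_def)
    have "q \<noteq> p" using q dp1 by auto
    then have "d (Suc q) \<le> -1" using great[of "Suc q"] q by simp
    then have "xs ! q \<in> B'" "xs ! q \<notin> B"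
      using d_Suc[of q] q p by (auto split: if_splits)
    then show ?thesis
      using exch[of q] great p q by (intro exI[of _ "xs ! q"]) auto
  qed
qed (use ne in \<open>auto simp: mem_bases_interval_system\<close>)

lemma matroid_image_interval_system:
  assumes f: "inj_on f (set xs)"
  shows "matroid_image f (interval_system xs l u) = interval_system (map f xs) l u"
proof (rule prod_eqI)
  have h: "height (map f xs) (f ` B) k = height xs B k" if "B \<subseteq> set xs" for B k
  proof -
    have sub: "set (take k xs) \<subseteq> set xs" by (rule set_take_subset)
    have "f ` B \<inter> f ` set (take k xs) = f ` (B \<inter> set (take k xs))"
      using inj_on_image_Int[OF f that sub] by simp
    moreover have "inj_on f (B \<inter> set (take k xs))"
      using f that by (meson inf.coboundedI1 inj_on_subset)
    ultimately show ?thesis by (simp add: height_def take_map card_image)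
  qed
  show "bases (matroid_image f (interval_system xs l u)) = bases (interval_system (map f xs) l u)"
  proof (intro subset_antisym subsetI)
    fix A assume "A \<in> bases (interval_system (map f xs) l u)"
    then have A: "A \<subseteq> f ` set xs"
      "\<And>k. k \<le> length xs \<Longrightarrow> l k \<le> int (height (map f xs) A k) \<and> int (height (map f xs) A k) \<le> u k"
      by (auto simp: mem_bases_interval_system)
    then obtain B where B: "B \<subseteq> set xs" "A = f ` B" by (meson subset_imageE)
    then have "B \<in> bases (interval_system xs l u)"
      using A(2) by (simp add: mem_bases_interval_system h)
    then show "A \<in> bases (matroid_image f (interval_system xs l u))" using B by simp
  next
    fix A assume "A \<in> bases (matroid_image f (interval_system xs l u))"
    then obtain B where "B \<in> bases (interval_system xs l u)" "A = f ` B" by auto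
    then show "A \<in> bases (interval_system (map f xs) l u)"
      by (simp add: mem_bases_interval_system h image_mono)
  qed
qed simp

section \<open>Comparing lattice paths step by step instead of along vertical lines\<close>

definition north :: "step list \<Rightarrow> nat \<Rightarrow> nat" where
  "north P k = count_list (take k P) North"

lemma count_East_North: "count_list P East + count_list P North = length P"
proof (induction P)
  case (Cons a P)
  then show ?case by (cases a) auto
qed simp

lemma north_0 [simp]: "north P 0 = 0"
  by (simp add: north_def)

lemma north_Suc:
  "k < length P \<Longrightarrow> north P (Suc k) = north P k + (if P ! k = North then 1 else 0)"
  by (simp add: north_def take_Suc_conv_app_nth)

lemma north_mono: "j \<le> k \<Longrightarrow> north P j \<le> north P k"
  using take_add[of j "k - j" P] by (simp add: north_def)

lemma north_le_add: "j \<le> k \<Longrightarrow> north P k \<le> north P j + (k - j)"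
  using take_add[of j "k - j" P] count_le_length[of "take (k - j) (drop j P)" North]
  by (simp add: north_def del: add_diff_assoc)

text \<open>Every step raises exactly one coordinate by one, so a point can only be reached after
  \<open>x + y\<close> steps.\<close>

lemma mem_path_points_iff: "(x, y) \<in> path_points P \<longleftrightarrow> x + y \<le> length P \<and> y = north P (x + y)"
proof -
  have "count_list (take k P) East + north P k = k" if "k \<le> length P" for k
    using count_East_North[of "take k P"] that by (simp add: north_def)
  then have "(x, y) = path_point P k \<longleftrightarrow> x + y = k \<and> y = north P k" if "k \<le> length P" for k
    using that by (force simp: path_point_def simp flip: north_def)
  then show ?thesis
    unfolding path_points_def by blast
qed

lemma path_points_north: "k \<le> length P \<Longrightarrow> (k - north P k, north P k) \<in> path_points P"
  using north_le_add[of 0 k P] by (simp add: mem_path_points_iff)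

text \<open>
  The point of \<open>Q\<close> on a given vertical line is found by the discrete intermediate value theorem,
  applied to the number of east steps.
\<close>

lemma path_points_east:
  assumes "i \<le> k" "k \<le> length Q" "i - north Q i \<le> x" "x \<le> k - north Q k"
  obtains j where "i \<le> j" "j \<le> k" "(x, north Q j) \<in> path_points Q"
proof -
  have le: "north Q j \<le> j" for j using north_le_add[of 0 j Q] by simp
  have "\<exists>j\<ge>i. j \<le> k \<and> int j - int (north Q j) = int x"
  proof (rule nat_intermed_int_val)
    show "\<forall>j. i \<le> j \<and> j < k \<longrightarrow>
        \<bar>int (Suc j) - int (north Q (Suc j)) - (int j - int (north Q j))\<bar> \<le> 1"
      using assms(2) by (simp add: north_Suc)
  qed (use assms le[of i] le[of k] in auto)
  then obtain j where j: "i \<le> j" "j \<le> k" "j = x + north Q j" by force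
  then show ?thesis using that[of j] assms by (simp add: mem_path_points_iff)
qed

text \<open>The point of \<open>Q\<close> above the \<open>k\<close>-th point of \<open>P\<close> is
  reached at a step \<open>j >= k\<close>, and it is higher by exactly \<open>j - k\<close>. From
  step \<open>k\<close> to step \<open>j\<close> the path \<open>Q\<close> rises by at most that
  amount, so it was already high enough at step \<open>k\<close>.\<close>

lemma weakly_below_imp_north_le:
  assumes "weakly_below P Q" "length P = length Q" "k \<le> length P"
  shows "north P k \<le> north Q k"
proof -
  obtain y where y: "(k - north P k, y) \<in> path_points Q" "north P k \<le> y"
    using assms path_points_north[of k P] by (force simp: weakly_below_def)
  define j where "j = k - north P k + y"
  have "north P k \<le> k" using north_le_add[of 0 k P] by simp
  then have "k \<le> j" "y + k = j + north P k" "y = north Q j" using y by (auto simp: j_def mem_path_points_iff)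
  then show ?thesis using north_le_add[of k j Q] by linarith
qed

text \<open>Mirror image: the lower point of \<open>Q\<close> is reached at a step
  \<open>j <= k\<close>, and from there \<open>Q\<close> gains at most \<open>k - j\<close> by step
  \<open>k\<close>.\<close>

lemma weakly_above_imp_north_ge:
  assumes "weakly_above P Q" "length P = length Q" "k \<le> length P"
  shows "north Q k \<le> north P k"
proof -
  obtain y where y: "(k - north P k, y) \<in> path_points Q" "y \<le> north P k"
    using assms path_points_north[of k P] by (force simp: weakly_above_def)
  define j where "j = k - north P k + y"
  have "north P k \<le> k" using north_le_add[of 0 k P] by simp
  then have "j \<le> k" "y + k = j + north P k" "y = north Q j" using y by (auto simp: j_def mem_path_points_iff)
  then show ?thesis using north_le_add[of j k Q] by linarith
qed

text \<open>After \<open>x + y\<close> steps \<open>Q\<close> is at least as high as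
  \<open>P\<close>, hence at or to the left of the vertical line at \<open>x\<close>. By the common
  endpoint it finishes at or to the right of that line, so it meets the line later, and by then it
  is no lower.\<close>

lemma weakly_below_if_north_le:
  assumes "length P = length Q" "north P (length P) = north Q (length Q)"
    and le: "\<And>k. k \<le> length P \<Longrightarrow> north P k \<le> north Q k"
  shows "weakly_below P Q"
  unfolding weakly_below_def
proof clarify
  fix x y assume "(x, y) \<in> path_points P"
  then have xy: "x + y \<le> length P" "y = north P (x + y)" by (auto simp: mem_path_points_iff)
  then have "north P (length P) \<le> y + (length P - (x + y))"
    using north_le_add[of "x + y" "length P" P] by simp
  then have "x \<le> length Q - north Q (length Q)" using assms(1,2) xy by linarith
  moreover have "y \<le> north Q (x + y)" using le[of "x + y"] xy by simp
  moreover from this have "x + y - north Q (x + y) \<le> x" by linarith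
  ultimately obtain j where "x + y \<le> j" "(x, north Q j) \<in> path_points Q"
    using path_points_east[of "x + y" "length Q" Q x] xy(1) assms(1) by auto
  then show "\<exists>y'. (x, y') \<in> path_points Q \<and> y \<le> y'"
    using north_mono[of "x + y" j Q] \<open>y \<le> north Q (x + y)\<close> by force
qed

text \<open>Here \<open>Q\<close> is followed backwards: it starts at abscissa 0 and after
  \<open>x + y\<close> steps is at or to the right of the line at \<open>x\<close>, so it met the
  line no later than that, at or below the point of \<open>P\<close>.\<close>

lemma weakly_above_if_north_ge:
  assumes "length P = length Q" and ge: "\<And>k. k \<le> length P \<Longrightarrow> north Q k \<le> north P k"
  shows "weakly_above P Q"
  unfolding weakly_above_def
proof clarify
  fix x y assume "(x, y) \<in> path_points P"
  then have xy: "x + y \<le> length P" "y = north P (x + y)" by (auto simp: mem_path_points_iff)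
  then have y: "north Q (x + y) \<le> y" using ge[of "x + y"] by simp
  then have "x \<le> x + y - north Q (x + y)" by linarith
  then obtain j where "j \<le> x + y" "(x, north Q j) \<in> path_points Q"
    using path_points_east[of 0 "x + y" Q x] xy(1) assms(1) by auto
  then show "\<exists>y'. (x, y') \<in> path_points Q \<and> y' \<le> y"
    using north_mono[of j "x + y" Q] y by force
qed

lemma north_map:
  assumes "distinct xs"
  shows "k \<le> length xs \<Longrightarrow> north (map (\<lambda>x. if x \<in> B then North else East) xs) k = height xs B k"
  by (induction k) (auto simp: north_Suc height_Suc[OF assms])

lemma lattice_path_matroid_eq:
  assumes U: "lattice_path m r U" and L: "lattice_path m r L"
  shows "lattice_path_matroid U L =
    interval_system [1..<Suc (length U)] (\<lambda>k. int (north L k)) (\<lambda>k. int (north U k))"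
proof (rule prod_eqI)
  let ?n = "length U" and ?xs = "[1..<Suc (length U)]"
  have len: "length L = ?n" "length ?xs = ?n"
    using U L count_East_North[of U] count_East_North[of L]
    by (auto simp: lattice_path_def simp del: upt_Suc)
  have end_eq: "north U ?n = north L ?n"
    using U L len by (simp add: lattice_path_def north_def)
  have lenP: "length (path_of ?n B) = ?n" for B by (simp add: path_of_def del: upt_Suc)
  have h: "north (path_of ?n B) k = height ?xs B k" if "k \<le> ?n" for B k
    unfolding path_of_def using that by (intro north_map) auto
  have "weakly_below (path_of ?n B) U \<and> weakly_above (path_of ?n B) L \<longleftrightarrow>
      (\<forall>k\<le>?n. north L k \<le> height ?xs B k \<and> height ?xs B k \<le> north U k)" (is "?l \<longleftrightarrow> ?r") for B
  proof
    assume ?l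
    then show ?r
      using weakly_below_imp_north_le[of "path_of ?n B" U]
        weakly_above_imp_north_ge[of "path_of ?n B" L] lenP len h by auto
  next
    assume r: ?r
    then have "height ?xs B ?n = north U ?n" by (metis end_eq le_antisym le_refl)
    then show ?l
      using r weakly_below_if_north_le[of "path_of ?n B" U]
        weakly_above_if_north_ge[of "path_of ?n B" L] lenP len h by auto
  qed
  then show "bases (lattice_path_matroid U L) =
      bases (interval_system ?xs (\<lambda>k. int (north L k)) (\<lambda>k. int (north U k)))"
    unfolding lattice_path_matroid_def interval_system_def Let_def len(2)
    by (simp add: atLeastLessThanSuc_atLeastAtMost del: upt_Suc)
  show "ground (lattice_path_matroid U L) =
      ground (interval_system ?xs (\<lambda>k. int (north L k)) (\<lambda>k. int (north U k)))"
    by (simp add: lattice_path_matroid_def Let_def atLeastLessThanSuc_atLeastAtMost del: upt_Suc)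
qed

section \<open>Passing between bounds on heights and lattice paths\<close>

lemma ex_path_with_heights:
  fixes h :: "nat \<Rightarrow> nat"
  assumes "h 0 = 0" and step: "\<And>k. k < n \<Longrightarrow> h k \<le> h (Suc k) \<and> h (Suc k) \<le> Suc (h k)"
  obtains P where "length P = n" "\<And>k. k \<le> n \<Longrightarrow> north P k = h k"
proof
  let ?P = "map (\<lambda>k. if h (Suc k) = h k then East else North) [0..<n]"
  show "length ?P = n" by simp
  show "north ?P k = h k" if "k \<le> n" for k
    using that
  proof (induction k)
    case (Suc k)
    then show ?case using step[of k] by (auto simp: north_Suc)
  qed (simp add: assms)
qed

lemma interval_system_in_LPM:
  assumes xs: "distinct xs" and ne: "bases (interval_system xs l u) \<noteq> {}"
    and n: "u (length xs) \<le> l (length xs)"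
  shows "interval_system xs l u \<in> LPM"
proof -
  let ?n = "length xs" and ?F = "bases (interval_system xs l u)" and ?ns = "[1..<Suc (length xs)]"
  \<comment> \<open>The envelopes of the family of bases replace \<open>l\<close> and
    \<open>u\<close>, which need not be heights of any path.\<close>
  define hi where "hi k = Max ((\<lambda>B. height xs B k) ` ?F)" for k
  define lo where "lo k = Min ((\<lambda>B. height xs B k) ` ?F)" for k
  have M: "matroid (interval_system xs l u)" by (rule matroid_interval_system[OF assms])
  have "?F \<subseteq> Pow (set xs)" by (auto simp: mem_bases_interval_system)
  then have fin: "finite ?F" using finite_subset by blast
  have hi: "height xs B k \<le> hi k" and lo: "lo k \<le> height xs B k" if "B \<in> ?F" for B k
    using that fin by (auto simp: hi_def lo_def)
  have hi_ex: "\<exists>B\<in>?F. hi k = height xs B k" and lo_ex: "\<exists>B\<in>?F. lo k = height xs B k" for k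
    using Max_in[of "(\<lambda>B. height xs B k) ` ?F"] Min_in[of "(\<lambda>B. height xs B k) ` ?F"] fin ne
    unfolding hi_def lo_def by (blast, blast)
  have mono: "height xs B k \<le> height xs B (Suc k)" "height xs B (Suc k) \<le> Suc (height xs B k)"
    if "k < ?n" for B k
    using height_Suc[OF xs that] by simp_all
  \<comment> \<open>Every single height function grows by 0 or 1 per step, and a pointwise maximum
    or minimum of such functions does so too.\<close>
  have hi_step: "hi k \<le> hi (Suc k) \<and> hi (Suc k) \<le> Suc (hi k)" if "k < ?n" for k
    using hi_ex[of k] hi_ex[of "Suc k"] hi mono[OF that]
    by (metis (no_types, lifting) Suc_le_mono le_trans)
  have lo_step: "lo k \<le> lo (Suc k) \<and> lo (Suc k) \<le> Suc (lo k)" if "k < ?n" for k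
    using lo_ex[of k] lo_ex[of "Suc k"] lo mono[OF that]
    by (metis (no_types, lifting) Suc_le_mono le_trans)
  obtain U where U: "length U = ?n" "\<And>k. k \<le> ?n \<Longrightarrow> north U k = hi k"
    using ex_path_with_heights[of hi ?n] hi_step hi_ex[of 0] by auto
  obtain L where L: "length L = ?n" "\<And>k. k \<le> ?n \<Longrightarrow> north L k = lo k"
    using ex_path_with_heights[of lo ?n] lo_step lo_ex[of 0] by auto
  have bound: "l k \<le> int (height xs B k)" "int (height xs B k) \<le> u k" if "B \<in> ?F" "k \<le> ?n" for B k
    using that by (auto simp: mem_bases_interval_system)
  have "hi ?n = lo ?n"
  proof -
    obtain B B' where "B \<in> ?F" "hi ?n = height xs B ?n" "B' \<in> ?F" "lo ?n = height xs B' ?n"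
      using hi_ex lo_ex by meson
    then show ?thesis
      using bound[of B ?n] bound[of B' ?n] n by simp
  qed
  then have end_eq: "north U ?n = north L ?n" using U L by simp
  have "lo k \<le> hi k" for k using ne hi lo by (meson equals0I le_trans)
  then have "weakly_below L U"
    using U L end_eq by (intro weakly_below_if_north_le) auto
  moreover have lp: "lattice_path (count_list U East) (count_list U North) U"
      "lattice_path (count_list U East) (count_list U North) L"
    using end_eq U L count_East_North[of U] count_East_North[of L]
    by (simp_all add: lattice_path_def north_def)
  moreover have "matroid_iso (lattice_path_matroid U L) (interval_system xs l u)"
  proof -
    \<comment> \<open>Lattice path matroids number their elements from 1, lists from 0.\<close>
    let ?f = "\<lambda>i. xs ! (i - 1)"
    have inj: "inj_on ?f (set ?ns)"
      using xs by (auto simp: inj_on_def nth_eq_iff_index_eq simp del: upt_Suc)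
    have map: "map ?f ?ns = xs" by (rule nth_equalityI) (auto simp del: upt_Suc)
    let ?N = "interval_system ?ns (\<lambda>k. int (north L k)) (\<lambda>k. int (north U k))"
    have img: "matroid_image ?f ?N = interval_system xs l u"
    proof -
      \<comment> \<open>The envelopes are attained by bases, so they lie between \<open>l\<close>
        and \<open>u\<close>; tightening the bounds to them therefore excludes no base and admits no
        new set.\<close>
      have "l k \<le> int (lo k)" "int (hi k) \<le> u k" if "k \<le> ?n" for k
        using hi_ex[of k] lo_ex[of k] bound that by metis+
      then have "bases (interval_system xs (\<lambda>k. int (north L k)) (\<lambda>k. int (north U k))) = ?F"
        using U L hi lo by (fastforce simp: mem_bases_interval_system)
      then show ?thesis
        by (simp only: matroid_image_interval_system[OF inj] map)
          (simp add: prod_eq_iff)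
    qed
    have "bases ?N \<noteq> {}" using img ne by (metis bases_matroid_image image_empty)
    then have "matroid ?N"
      using end_eq by (intro matroid_interval_system) (auto simp del: upt_Suc)
    then show ?thesis
      unfolding lattice_path_matroid_eq[OF lp] U(1)
      using inj img M by (subst matroid_iso_iff_image) (auto simp del: upt_Suc)
  qed
  ultimately show ?thesis using M unfolding LPM_def by blast
qed

lemma LPM_interval_systemE:
  assumes "M \<in> LPM"
  obtains xs l u where "distinct xs" "u (length xs) \<le> l (length xs)" "bases M \<noteq> {}"
    "M = interval_system xs l u"
proof -
  obtain m r U L where M: "matroid M" and lp: "lattice_path m r U" "lattice_path m r L"
    and iso: "matroid_iso (lattice_path_matroid U L) M"
    using assms unfolding LPM_def by blast
  let ?ns = "[1..<Suc (length U)]"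
  let ?N = "interval_system ?ns (\<lambda>k. int (north L k)) (\<lambda>k. int (north U k))"
  have len: "length L = length U"
    using lp count_East_North[of U] count_East_North[of L] by (simp add: lattice_path_def)
  then have end_eq: "north U (length U) = north L (length U)"
    using lp by (simp add: lattice_path_def north_def)
  have iso: "matroid_iso ?N M" using iso lattice_path_matroid_eq[OF lp] by simp
  \<comment> \<open>A base of \<open>M\<close> is pulled back along the isomorphism. With this
    \<open>?N\<close> is known to be a matroid, and the isomorphism can be rewritten as an
    image.\<close>
  have "bases ?N \<noteq> {}"
  proof -
    obtain f where f: "f ` ground ?N = ground M"
      and eq: "\<And>B. B \<subseteq> ground ?N \<Longrightarrow> B \<in> bases ?N \<longleftrightarrow> f ` B \<in> bases M"
      using iso unfolding matroid_iso_def bij_betw_def by blast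
    obtain A where A: "A \<in> bases M" using matroidD(2)[OF M] by blast
    then have "A \<subseteq> f ` ground ?N" using matroidD(3)[OF M] f by blast
    then obtain B where "B \<subseteq> ground ?N" "A = f ` B" by (meson subset_imageE)
    then show ?thesis using eq[of B] A by blast
  qed
  then have N: "matroid ?N"
    using end_eq by (intro matroid_interval_system) (auto simp del: upt_Suc)
  obtain f where f: "inj_on f (ground ?N)" "M = matroid_image f ?N"
    using iso matroid_iso_iff_image[OF N M] by blast
  then have inj: "inj_on f (set ?ns)" by simp
  have "M = interval_system (map f ?ns) (\<lambda>k. int (north L k)) (\<lambda>k. int (north U k))"
    unfolding f(2) by (rule matroid_image_interval_system[OF inj])
  moreover have "distinct (map f ?ns)"
    using inj by (simp add: distinct_map del: upt_Suc)
  moreover have "int (north U (length (map f ?ns))) \<le> int (north L (length (map f ?ns)))"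
    using end_eq by (simp del: upt_Suc)
  ultimately show ?thesis
    using that[of "map f ?ns" "\<lambda>k. int (north U k)" "\<lambda>k. int (north L k)"] matroidD(2)[OF M]
    by simp
qed

lemma matroid_LPM: "M \<in> LPM \<Longrightarrow> matroid M"
  by (simp add: LPM_def)

section \<open>Operations under which lattice path matroids are closed\<close>

lemma height_complement:
  assumes "distinct xs" "k \<le> length xs" "B \<subseteq> set xs"
  shows "int (height xs (set xs - B) k) = int k - int (height xs B k)"
proof -
  have "(set xs - B) \<inter> set (take k xs) = set (take k xs) - B \<inter> set (take k xs)"
    using set_take_subset[of k xs] by blast
  moreover have "card (set (take k xs)) = k"
    using assms by (simp add: distinct_card)
  ultimately have "height xs (set xs - B) k + height xs B k = k"
    using card_Int_Diff[of "set (take k xs)" B] unfolding height_def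
    by (simp add: Int_commute Diff_Int)
  then show ?thesis by linarith
qed

text \<open>Complementation interchanges north and east steps; this reflects the two bounds and
  swaps their roles.\<close>

lemma LPM_dual:
  assumes "M \<in> LPM"
  shows "dual M \<in> LPM"
proof -
  obtain xs l u where xs: "distinct xs" "u (length xs) \<le> l (length xs)" "bases M \<noteq> {}"
    and M: "M = interval_system xs l u"
    using LPM_interval_systemE[OF assms(1)] by metis
  let ?l = "\<lambda>k. int k - u k" and ?u = "\<lambda>k. int k - l k"
  have "dual M = interval_system xs ?l ?u"
  proof (rule prod_eqI)
    have sub: "set xs - B \<in> bases (interval_system xs (\<lambda>k. int k - u k) (\<lambda>k. int k - l k))"
      if "B \<in> bases (interval_system xs l u)" for B l u
      using that height_complement[OF xs(1)] by (auto simp: mem_bases_interval_system)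
    show "bases (dual M) = bases (interval_system xs ?l ?u)"
    proof (intro subset_antisym subsetI)
      fix A assume A: "A \<in> bases (interval_system xs ?l ?u)"
      then have "set xs - A \<in> bases M" using sub[OF A] M by simp
      moreover have "A = set xs - (set xs - A)" using A by (auto simp: mem_bases_interval_system)
      ultimately show "A \<in> bases (dual M)" by (auto simp: bases_dual M)
    qed (use sub in \<open>auto simp: bases_dual M\<close>)
  qed (simp add: M)
  moreover have "bases (dual M) \<noteq> {}" using xs by (simp add: bases_dual)
  ultimately show ?thesis
    using interval_system_in_LPM[OF xs(1), of ?l ?u] xs(2) by simp
qed

text \<open>A base-cobase satisfies the original bounds and the reflected ones, hence the larger
  lower bound and the smaller upper bound. Tightening keeps the final height pinned down.\<close>

lemma LPM_base_cobases:
  assumes "M \<in> LPM" "base_cobases M \<noteq> {}"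
  shows "(ground M, base_cobases M) \<in> LPM"
proof -
  obtain xs l u where xs: "distinct xs" "u (length xs) \<le> l (length xs)" "bases M \<noteq> {}"
    and M: "M = interval_system xs l u"
    using LPM_interval_systemE[OF assms(1)] by metis
  let ?l = "\<lambda>k. max (l k) (int k - u k)" and ?u = "\<lambda>k. min (u k) (int k - l k)"
  have "base_cobases M = bases (interval_system xs ?l ?u)"
    using height_complement[OF xs(1)]
    by (fastforce simp: base_cobases_def M mem_bases_interval_system)
  then have eq: "(ground M, base_cobases M) = interval_system xs ?l ?u"
    by (simp add: prod_eq_iff M)
  moreover have "bases (interval_system xs ?l ?u) \<noteq> {}"
    using assms(2) by (simp flip: eq)
  ultimately show ?thesis
    using interval_system_in_LPM[OF xs(1), of ?l ?u] xs(2) by simp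
qed

lemma LPM_add_loop:
  assumes "M \<in> LPM" and e: "e \<notin> ground M"
  shows "add_loop e M \<in> LPM"
proof -
  obtain xs l u where xs: "distinct xs" "u (length xs) \<le> l (length xs)" "bases M \<noteq> {}"
    and M: "M = interval_system xs l u"
    using LPM_interval_systemE[OF assms(1)] by metis
  let ?n = "length xs"
  \<comment> \<open>The new element is placed last, and \<open>min\<close> freezes the bounds there,
    so the extra step is forced to go east.\<close>
  let ?l = "\<lambda>k. l (min k ?n)" and ?u = "\<lambda>k. u (min k ?n)"
  have e': "e \<notin> set xs" using e M by simp
  have h: "height (xs @ [e]) B k = height xs B k" if "k \<le> ?n" for B k
    using that by (simp add: height_def)
  have hn: "height (xs @ [e]) B (Suc ?n) = height xs B ?n + (if e \<in> B then 1 else 0)" for B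
    using e' by (simp add: height_def)
  have "bases M = bases (interval_system (xs @ [e]) ?l ?u)"
  proof (intro subset_antisym subsetI)
    fix B assume "B \<in> bases M"
    then have B: "B \<subseteq> set xs" "\<And>k. k \<le> ?n \<Longrightarrow> l k \<le> int (height xs B k) \<and> int (height xs B k) \<le> u k"
      by (auto simp: M mem_bases_interval_system)
    then have "e \<notin> B" using e' by blast
    then show "B \<in> bases (interval_system (xs @ [e]) ?l ?u)"
      using B h hn[of B] by (auto simp: mem_bases_interval_system le_Suc_eq)
  next
    fix B assume "B \<in> bases (interval_system (xs @ [e]) ?l ?u)"
    then have B: "B \<subseteq> insert e (set xs)" and bound: "\<And>k. k \<le> Suc ?n \<Longrightarrow>
        ?l k \<le> int (height (xs @ [e]) B k) \<and> int (height (xs @ [e]) B k) \<le> ?u k"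
      by (auto simp: mem_bases_interval_system)
    \<comment> \<open>The heights at the last two indices obey the same bounds with
      \<open>u <= l\<close>, so they are equal and the last step is not north.\<close>
    have "e \<notin> B"
      using bound[of ?n] bound[of "Suc ?n"] xs(2) h[of ?n B] hn[of B] by (auto split: if_splits)
    moreover have "l k \<le> int (height xs B k) \<and> int (height xs B k) \<le> u k" if "k \<le> ?n" for k
      using bound[of k] that h[of k B] by simp
    ultimately show "B \<in> bases M"
      using B by (auto simp: M mem_bases_interval_system)
  qed
  then have "add_loop e M = interval_system (xs @ [e]) ?l ?u"
    by (simp add: prod_eq_iff M)
  moreover from this have "bases (interval_system (xs @ [e]) ?l ?u) \<noteq> {}"
    using xs(3) by (metis bases_add_loop)
  ultimately show ?thesis
    using interval_system_in_LPM[of "xs @ [e]" ?l ?u] xs e' by simp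
qed

lemma LPM_delete_noncoloop:
  assumes "M \<in> LPM" and B0: "B0 \<in> bases M" "e \<notin> B0" and e: "e \<in> ground M"
  shows "delete M e \<in> LPM"
proof -
  obtain xs l u where xs: "distinct xs" "u (length xs) \<le> l (length xs)" "bases M \<noteq> {}"
    and M: "M = interval_system xs l u"
    using LPM_interval_systemE[OF assms(1)] by metis
  obtain ys zs where yz: "xs = ys @ e # zs"
    using e by (auto simp: M dest: split_list)
  let ?i = "length ys" and ?m = "length (ys @ zs)"
  \<comment> \<open>Without the step at position \<open>?i\<close>, the old indices
    \<open>?i\<close> and \<open>?i + 1\<close> carry the same height. At \<open>k = ?i\<close> both
    old constraints apply, which is why the two case distinctions differ in \<open><=\<close> and
    \<open><\<close>; later indices shift by one.\<close>
  let ?l = "\<lambda>k. max (if k \<le> ?i then l k else l (Suc k)) (if k < ?i then l k else l (Suc k))"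
  let ?u = "\<lambda>k. min (if k \<le> ?i then u k else u (Suc k)) (if k < ?i then u k else u (Suc k))"
  have h: "height xs B k = height (ys @ zs) B (if k \<le> ?i then k else k - 1)" if "e \<notin> B" for B k
  proof (cases "k \<le> ?i")
    case False
    then obtain j where "k = ?i + Suc j" by (metis add_Suc_right less_imp_Suc_add not_le)
    then show ?thesis using that by (simp add: height_def yz)
  qed (simp add: height_def yz)
  have bounds: "(\<forall>k\<le>Suc ?m. l k \<le> H (if k \<le> ?i then k else k - 1) \<and> H (if k \<le> ?i then k else k - 1) \<le> u k)
      \<longleftrightarrow> (\<forall>k\<le>?m. ?l k \<le> H k \<and> H k \<le> ?u k)" (is "?L \<longleftrightarrow> ?R") for H :: "nat \<Rightarrow> int"
  proof
    assume L: ?L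
    show ?R
    proof (intro allI impI)
      fix k assume "k \<le> ?m"
      moreover have "k < ?i \<or> k = ?i \<or> ?i < k" by linarith
      ultimately show "?l k \<le> H k \<and> H k \<le> ?u k"
        using L[rule_format, of k] L[rule_format, of "Suc k"] by auto
    qed
  next
    assume R: ?R
    show ?L
    proof (intro allI impI)
      fix k assume "k \<le> Suc ?m"
      then show "l k \<le> H (if k \<le> ?i then k else k - 1) \<and> H (if k \<le> ?i then k else k - 1) \<le> u k"
        using R[rule_format, of k] R[rule_format, of "k - 1"]
        by (cases k; cases "k \<le> ?i") auto
    qed
  qed
  have "B \<in> bases M \<and> e \<notin> B \<longleftrightarrow> B \<in> bases (interval_system (ys @ zs) ?l ?u)" for B
  proof (cases "e \<in> B")
    case True
    then show ?thesis using xs(1) by (auto simp: mem_bases_interval_system yz)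
  next
    case False
    have len: "length xs = Suc ?m" by (simp add: yz)
    have "B \<subseteq> set xs \<longleftrightarrow> B \<subseteq> set (ys @ zs)" using False by (auto simp: yz)
    then show ?thesis
      using bounds[of "\<lambda>k. int (height (ys @ zs) B k)"] False
      unfolding M mem_bases_interval_system len h[OF False] by blast
  qed
  then have "bases (delete M e) = bases (interval_system (ys @ zs) ?l ?u)"
    unfolding bases_delete[OF matroid_LPM[OF assms(1)] B0] by blast
  moreover have "ground (delete M e) = ground (interval_system (ys @ zs) ?l ?u)"
    using xs(1) by (auto simp: M yz)
  ultimately have eq: "delete M e = interval_system (ys @ zs) ?l ?u"
    by (simp add: prod_eq_iff)
  have "bases (interval_system (ys @ zs) ?l ?u) \<noteq> {}"
    unfolding eq[symmetric] using matroidD(2)[OF matroid_delete[OF matroid_LPM[OF assms(1)]]] .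
  moreover have "?u ?m \<le> ?l ?m" using xs(2) by (auto simp: yz)
  moreover have "distinct (ys @ zs)" using xs(1) yz by simp
  ultimately show ?thesis
    unfolding eq using interval_system_in_LPM by blast
qed

text \<open>A coloop is treated in the dual, where it is a loop and so avoided by every base; for a
  loop deletion equals contraction, which leads back to \<open>delete M e\<close>.\<close>

lemma LPM_delete:
  assumes "M \<in> LPM" "e \<in> ground M"
  shows "delete M e \<in> LPM"
proof (cases "\<exists>B\<in>bases M. e \<notin> B")
  case True
  then show ?thesis using LPM_delete_noncoloop[OF assms(1) _ _ assms(2)] by metis
next
  case False
  note M = matroid_LPM[OF assms(1)]
  obtain B where B: "B \<in> bases (dual M)"
    using matroidD(2)[OF matroid_dual[OF M]] by blast
  have loop: "\<not> indep (dual M) {e}"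
    using False by (auto simp: indep_def bases_dual)
  then have "e \<notin> B" using B by (auto simp: indep_def)
  then have "delete (dual M) e \<in> LPM"
    using LPM_delete_noncoloop[OF LPM_dual[OF assms(1)] B] assms(2) by simp
  moreover have "dual (delete M e) = delete (dual M) e"
    using contract_loop[OF matroid_dual[OF M] _ loop] assms(2) contract_dual[OF M] by simp
  ultimately have "dual (dual (delete M e)) \<in> LPM" using LPM_dual by metis
  then show ?thesis
    using matroidD(3)[OF matroid_delete[OF M]] by (simp add: dual_dual)
qed

section \<open>Closure properties of the series-parallel class\<close>

text \<open>
  Generating the class by parallel extensions and duality halves every induction: series extensions
  are dual to parallel ones.
\<close>

inductive_set SP :: "'a matroid set" where
  SP_LPM: "M \<in> LPM \<Longrightarrow> M \<in> SP"
| SP_parallel: "M \<in> SP \<Longrightarrow> parallel_extension N M \<Longrightarrow> N \<in> SP"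
| SP_dual: "M \<in> SP \<Longrightarrow> dual M \<in> SP"

lemma matroid_SP: "M \<in> SP \<Longrightarrow> matroid M"
  by (induction rule: SP.induct) (auto simp: matroid_LPM parallel_extension_def matroid_dual)

lemma dual_dual_matroid: "matroid M \<Longrightarrow> dual (dual M) = M"
  by (simp add: dual_dual matroidD(3))

text \<open>Renaming within the element type serves two purposes: it absorbs the isomorphism rule of
  \<open>spex\<close>, and it lets one member of a parallel pair take the place of the
  other.\<close>

lemma SP_matroid_image:
  fixes f :: "'a \<Rightarrow> 'a"
  shows "M \<in> SP \<Longrightarrow> inj_on f (ground M) \<Longrightarrow> matroid_image f M \<in> SP"
proof (induction rule: SP.induct)
  case (SP_LPM M)
  obtain xs l u where xs: "distinct xs" "u (length xs) \<le> l (length xs)" "bases M \<noteq> {}"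
    and M: "M = interval_system xs l u"
    using LPM_interval_systemE[OF SP_LPM(1)] by metis
  have eq: "matroid_image f M = interval_system (map f xs) l u"
    using SP_LPM(2) unfolding M by (intro matroid_image_interval_system) simp
  have "bases (interval_system (map f xs) l u) \<noteq> {}"
    unfolding eq[symmetric] using xs(3) by simp
  moreover have "distinct (map f xs)"
    using xs(1) SP_LPM(2) by (simp add: M distinct_map)
  ultimately have "matroid_image f M \<in> LPM"
    unfolding eq using xs(2) by (intro interval_system_in_LPM) auto
  then show ?case by (rule SP.SP_LPM)
next
  case (SP_parallel M N)
  then obtain g h where N: "matroid N" and p: "parallel_pair N g h" and del: "delete N g = M"
    by (auto simp: parallel_extension_iff)
  note f = SP_parallel.prems and gh = parallel_pair_ground[OF N p]
  obtain B0 where B0: "B0 \<in> bases N" "g \<notin> B0" using parallel_pair_noncoloop[OF p] by metis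
  have "inj_on f (ground M)" using f by (auto simp: del[symmetric] intro: inj_on_subset)
  then have "matroid_image f M \<in> SP" by (rule SP_parallel.IH)
  moreover have "parallel_pair (matroid_image f N) (f g) (f h)"
    using p gh indep_matroid_image[OF N f, of "{g}"] indep_matroid_image[OF N f, of "{h}"]
      indep_matroid_image[OF N f, of "{g, h}"] inj_on_eq_iff[OF f gh]
    by (simp add: parallel_pair_def)
  then have "parallel_extension (matroid_image f N) (matroid_image f M)"
    unfolding parallel_extension_iff del[symmetric]
    using delete_matroid_image[OF N f gh(1) B0] matroid_matroid_image[OF N f] by metis
  ultimately show ?case by (rule SP.SP_parallel)
next
  case (SP_dual M)
  then show ?case
    using dual_matroid_image[OF matroid_SP[OF SP_dual(1)], of f] SP.SP_dual by fastforce
qed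

lemma spex_LPM_subset_SP: "M \<in> spex LPM \<Longrightarrow> M \<in> SP"
proof (induction rule: spex.induct)
  case (series M N)
  then have N: "matroid N" by (simp add: series_extension_def)
  then obtain g h where p: "parallel_pair (dual N) g h" and M: "contract N g = M"
    using series.hyps series_extension_iff by blast
  have "parallel_extension (dual N) (dual M)"
    unfolding parallel_extension_iff M[symmetric]
    using p delete_dual[OF N] matroid_dual[OF N] by blast
  then have "dual N \<in> SP" using series.IH SP_dual SP_parallel by blast
  then show ?case using SP_dual dual_dual_matroid[OF N] by fastforce
next
  case (iso M N)
  then show ?case
    using matroid_iso_iff_image[OF matroid_SP[OF iso.IH]] SP_matroid_image by blast
qed (blast intro: SP.intros)+

text \<open>With the dual included in the claim, the duality rule only swaps its two halves, and
  each parallel extension is matched by a series extension of the dual.\<close>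

lemma SP_subset_spex_LPM: "M \<in> SP \<Longrightarrow> M \<in> spex LPM \<and> dual M \<in> spex LPM"
proof (induction rule: SP.induct)
  case (SP_LPM M)
  then show ?case using LPM_dual spex.base by blast
next
  case (SP_parallel M N)
  then obtain g h where N: "matroid N" and p: "parallel_pair N g h" and del: "delete N g = M"
    by (auto simp: parallel_extension_iff)
  have "series_extension (dual N) (dual M)"
    unfolding series_extension_iff[OF matroid_dual[OF N]] dual_dual_matroid[OF N] del[symmetric]
    using p contract_dual[OF N] by blast
  then show ?case using SP_parallel spex.parallel spex.series by blast
next
  case (SP_dual M)
  then show ?case using dual_dual_matroid[OF matroid_SP] by metis
qed

text \<open>Both claims are carried together because duality exchanges them. A parallel pair stays
  parallel after adding \<open>e\<close>, and deleting its member \<open>g\<close> commutes with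
  that addition.\<close>

lemma SP_add_loop_coloop:
  "M \<in> SP \<Longrightarrow> e \<notin> ground M \<Longrightarrow> add_loop e M \<in> SP \<and> add_coloop e M \<in> SP"
proof (induction rule: SP.induct)
  case (SP_LPM M)
  note M = matroid_LPM[OF SP_LPM(1)]
  have "add_loop e (dual M) \<in> LPM" "add_loop e M \<in> LPM"
    using SP_LPM LPM_dual LPM_add_loop by (metis ground_dual)+
  moreover have "add_coloop e M = dual (add_loop e (dual M))"
    using dual_add_loop[OF matroid_dual[OF M], of e] SP_LPM(2) dual_dual_matroid[OF M] by simp
  ultimately show ?case by (simp add: LPM_dual SP.SP_LPM)
next
  case (SP_parallel M N)
  then obtain g h where N: "matroid N" and p: "parallel_pair N g h" and del: "delete N g = M"
    by (auto simp: parallel_extension_iff)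
  note e = SP_parallel.prems and gh = parallel_pair_ground[OF N p]
  have ne: "g \<noteq> e" "h \<noteq> e" using e gh by auto
  obtain B0 where B0: "B0 \<in> bases N" "g \<notin> B0" using parallel_pair_noncoloop[OF p] by metis
  have SP: "add_loop e M \<in> SP" "add_coloop e M \<in> SP"
    using SP_parallel.IH e by (auto simp: del[symmetric])
  have "parallel_pair (add_loop e N) g h"
    using p by (simp add: parallel_pair_def indep_def)
  moreover have "delete (add_loop e N) g = add_loop e M"
    using bases_delete[OF matroid_add_loop[OF N, of e], of B0 g] bases_delete[OF N B0] B0 ne
    by (simp add: prod_eq_iff del[symmetric] insert_Diff_if)
  ultimately have 1: "parallel_extension (add_loop e N) (add_loop e M)"
    using matroid_add_loop[OF N] parallel_extension_iff by blast
  have "parallel_pair (add_coloop e N) g h"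
    using p ne by (simp add: parallel_pair_def indep_def)
  moreover have "{B \<in> insert e ` bases N. g \<notin> B} = insert e ` {B \<in> bases N. g \<notin> B}"
    using ne by blast
  then have "delete (add_coloop e N) g = add_coloop e M"
    using bases_delete[OF matroid_add_coloop[OF N e], of "insert e B0" g] bases_delete[OF N B0] B0 ne
    by (simp add: prod_eq_iff del[symmetric] insert_Diff_if)
  ultimately have "parallel_extension (add_coloop e N) (add_coloop e M)"
    using matroid_add_coloop[OF N e] parallel_extension_iff by blast
  with 1 show ?case using SP SP.SP_parallel by blast
next
  case (SP_dual M)
  then have e: "e \<notin> ground M" by simp
  have M: "matroid M" using SP_dual matroid_SP by blast
  show ?case
    using SP_dual.IH[OF e] SP.SP_dual dual_add_loop[OF M e] dual_add_coloop[OF M e] by metis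
qed

section \<open>Minors of the series-parallel class\<close>

lemma contract_parallel:
  assumes M: "matroid M" and p: "parallel_pair M g h"
  shows "contract M h = add_loop g (contract (delete M g) h)"
    and "contract M g = add_loop h (contract (delete M g) h)"
    and "\<And>X. X \<in> bases (contract (delete M g) h) \<longleftrightarrow> h \<notin> X \<and> insert h X \<in> bases M"
proof -
  note gh = parallel_pair_ground[OF M p]
  have ne: "g \<noteq> h" and ind: "indep M {g}" "indep M {h}" using p by (auto simp: parallel_pair_def)
  obtain B0 where B0: "B0 \<in> bases M" "g \<notin> B0" using parallel_pair_noncoloop[OF p] by metis
  have "indep (delete M g) {h}" using ind ne by (simp add: indep_delete[OF M])
  then have "bases (contract (delete M g) h) = {B - {h} | B. B \<in> bases M \<and> g \<notin> B \<and> h \<in> B}"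
    by (simp add: bases_contract[OF matroid_delete[OF M]] bases_delete[OF M B0])
  also have "\<dots> = {B - {h} | B. B \<in> bases M \<and> h \<in> B}"
    using parallel_pair_not_both[OF p] by blast
  finally have b: "bases (contract (delete M g) h) = {B - {h} | B. B \<in> bases M \<and> h \<in> B}" .
  have h: "bases (contract M h) = bases (contract (delete M g) h)"
    by (simp add: b bases_contract[OF M ind(2)])
  then show "contract M h = add_loop g (contract (delete M g) h)"
    using gh ne by (auto simp: prod_eq_iff)
  \<comment> \<open>Swapping the pair turns a base through \<open>g\<close> into one through
    \<open>h\<close> with the same remainder; used in both directions, it shows that the two
    contractions have the same bases.\<close>
  have sub: "\<exists>B'. B - {g} = B' - {h} \<and> B' \<in> bases M \<and> h \<in> B'"
    if "parallel_pair M g h" "B \<in> bases M" "g \<in> B" for B g h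
    using parallel_pair_swap[OF M that] parallel_pair_not_both[OF that]
    by (intro exI[of _ "insert h (B - {g})"]) auto
  have "bases (contract M g) = bases (contract (delete M g) h)"
    unfolding b bases_contract[OF M ind(1)]
    using sub[OF p] sub[OF parallel_pair_sym[OF p]] by blast
  then show "contract M g = add_loop h (contract (delete M g) h)"
    using gh ne by (auto simp: prod_eq_iff)
  show "X \<in> bases (contract (delete M g) h) \<longleftrightarrow> h \<notin> X \<and> insert h X \<in> bases M" for X
    unfolding b by (auto simp: insert_absorb intro!: exI[of _ "insert h X"])
qed

lemma delete_commute:
  assumes "matroid M"
  shows "delete (delete M e) g = delete (delete M g) e"
  using assms by (intro matroid_eqI) (auto simp: matroid_delete indep_delete)

lemma delete_contract_commute:
  assumes M: "matroid M" and e: "indep M {e}" "e \<noteq> g"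
  shows "delete (contract M e) g = contract (delete M g) e"
proof -
  have "indep (delete M g) {e}" using e by (simp add: indep_delete[OF M])
  then show ?thesis
    using assms by (intro matroid_eqI)
      (auto simp: matroid_delete matroid_contract indep_delete indep_contract)
qed

lemma SP_delete_parallel_step:
  assumes N: "matroid N" and p: "parallel_pair N g h" and e: "e \<in> ground N"
    and SP: "delete N g \<in> SP" and IH: "e \<noteq> g \<Longrightarrow> delete (delete N g) e \<in> SP"
  shows "delete N e \<in> SP"
proof -
  note gh = parallel_pair_ground[OF N p]
  have ne: "g \<noteq> h" using p by (simp add: parallel_pair_def)
  consider "e = g" | "e = h" | "e \<noteq> g" "e \<noteq> h" by blast
  then show ?thesis
  proof cases
    case 1
    then show ?thesis using SP by simp
  next
    case 2
    \<comment> \<open>Parallel elements are interchangeable: deleting \<open>h\<close> is deleting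
      \<open>g\<close> and then renaming the surviving \<open>h\<close> to \<open>g\<close>.\<close>
    let ?f = "id(h := g)"
    obtain B0 where B0: "B0 \<in> bases N" "g \<notin> B0" using parallel_pair_noncoloop[OF p] by metis
    obtain B1 where B1: "B1 \<in> bases N" "h \<notin> B1"
      using parallel_pair_noncoloop[OF parallel_pair_sym[OF p]] by metis
    have im: "?f ` B = (if h \<in> B then insert g (B - {h}) else B)" for B by auto
    have "{B \<in> bases N. h \<notin> B} = (`) ?f ` {B \<in> bases N. g \<notin> B}"
    proof (intro subset_antisym subsetI)
      fix B assume B: "B \<in> {B \<in> bases N. h \<notin> B}"
      show "B \<in> (`) ?f ` {B \<in> bases N. g \<notin> B}"
      proof (cases "g \<in> B")
        case True
        then have "insert h (B - {g}) \<in> bases N" using B parallel_pair_swap[OF N p] by blast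
        moreover have "B = ?f ` insert h (B - {g})"
          unfolding im using B True by auto
        ultimately show ?thesis using ne by blast
      next
        case False
        moreover have "B = ?f ` B" using B unfolding im by simp
        ultimately show ?thesis using B by blast
      qed
    next
      fix A assume "A \<in> (`) ?f ` {B \<in> bases N. g \<notin> B}"
      then obtain B where B: "B \<in> bases N" "g \<notin> B" "A = ?f ` B" by blast
      then show "A \<in> {B \<in> bases N. h \<notin> B}"
        using parallel_pair_swap[OF N parallel_pair_sym[OF p], of B] ne unfolding im by auto
    qed
    moreover have "ground N - {h} = ?f ` (ground N - {g})"
      using gh ne unfolding im by auto
    ultimately have "delete N h = matroid_image ?f (delete N g)"
      by (simp add: prod_eq_iff bases_delete[OF N B0] bases_delete[OF N B1] del: fun_upd_apply)
    moreover have "inj_on ?f (ground (delete N g))" by (auto simp: inj_on_def)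
    ultimately show ?thesis using SP_matroid_image[OF SP] 2 by metis
  next
    case 3
    have "parallel_pair (delete N e) g h"
      using p 3 by (simp add: parallel_pair_def indep_delete[OF N])
    then have "parallel_extension (delete N e) (delete (delete N g) e)"
      using matroid_delete[OF N] delete_commute[OF N] parallel_extension_iff by metis
    then show ?thesis using IH 3 SP_parallel by blast
  qed
qed

text \<open>Contracting one of the pair turns the other into a loop. A loop \<open>e\<close> may be
  deleted instead. For any other \<open>e\<close>, the pair either remains parallel after
  contraction or degenerates to loops.\<close>

lemma SP_contract_parallel_step:
  assumes N: "matroid N" and p: "parallel_pair N g h" and e: "e \<in> ground N"
    and SP: "delete N e \<in> SP" and IH: "\<And>e. e \<in> ground N \<Longrightarrow> e \<noteq> g \<Longrightarrow> contract (delete N g) e \<in> SP"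
  shows "contract N e \<in> SP"
proof -
  note gh = parallel_pair_ground[OF N p]
  have ne: "g \<noteq> h" using p by (simp add: parallel_pair_def)
  consider "e = g" | "e = h" | "\<not> indep N {e}" | "e \<noteq> g" "e \<noteq> h" "indep N {e}" by blast
  then show ?thesis
  proof cases
    case 1
    then show ?thesis
      using contract_parallel(2)[OF N p] SP_add_loop_coloop[OF IH[OF gh(2)], of h] ne by simp
  next
    case 2
    then show ?thesis
      using contract_parallel(1)[OF N p] SP_add_loop_coloop[OF IH[OF gh(2)], of g] ne by simp
  next
    case 3
    then show ?thesis using contract_loop[OF N e] SP by simp
  next
    case 4
    have del: "delete (contract N e) g = contract (delete N g) e"
      using delete_contract_commute[OF N 4(3,1)] .
    have SP': "contract (delete N g) e \<in> SP" using IH e 4 by blast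
    note C = matroid_contract[OF N, of e]
    \<comment> \<open>If \<open>{e, g}\<close> is independent, then so is \<open>{e, h}\<close> by
      swapping, and the pair survives. Otherwise \<open>g\<close> is a loop of the contraction and
      is added back to \<open>contract (delete N g) e\<close> as such.\<close>
    show ?thesis
    proof (cases "indep N {e, g}")
      case True
      then obtain B where B: "B \<in> bases N" "e \<in> B" "g \<in> B" by (auto simp: indep_def)
      then have "insert h (B - {g}) \<in> bases N" using parallel_pair_swap[OF N p] by blast
      moreover have "{e, h} \<subseteq> insert h (B - {g})" using B 4 by simp
      ultimately have "indep N {e, h}" unfolding indep_def by metis
      moreover have "\<not> indep N {e, g, h}"
        using p unfolding parallel_pair_def indep_def by (metis insert_subset)
      ultimately have "parallel_pair (contract N e) g h"
        using True 4 ne by (simp add: parallel_pair_def indep_contract[OF N])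
      then have "parallel_extension (contract N e) (contract (delete N g) e)"
        using C del parallel_extension_iff by metis
      then show ?thesis using SP' SP_parallel by blast
    next
      case False
      then have loop: "g \<notin> B" if "B \<in> bases (contract N e)" for B
        using that by (auto simp: bases_contract[OF N 4(3)] indep_def)
      obtain B0 where B0: "B0 \<in> bases (contract N e)" using matroidD(2)[OF C] by blast
      have "bases (delete (contract N e) g) = bases (contract N e)"
        using bases_delete[OF C B0 loop[OF B0]] loop by auto
      then have "contract N e = add_loop g (contract (delete N g) e)"
        unfolding del[symmetric] using gh 4 by (auto simp: prod_eq_iff)
      then show ?thesis using SP_add_loop_coloop[OF SP', of g] by simp
    qed
  qed
qed

text \<open>Deletion and contraction are proved jointly: duality interchanges them, and the
  contraction step draws on the deletion just obtained.\<close>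

lemma SP_minors: "M \<in> SP \<Longrightarrow> e \<in> ground M \<Longrightarrow> delete M e \<in> SP \<and> contract M e \<in> SP"
proof (induction arbitrary: e rule: SP.induct)
  case (SP_LPM M)
  then have "delete M e \<in> LPM" "delete (dual M) e \<in> LPM"
    using LPM_delete LPM_dual by (metis ground_dual)+
  then show ?case by (simp add: contract_def LPM_dual SP.SP_LPM)
next
  case (SP_parallel M N)
  then obtain g h where N: "matroid N" and p: "parallel_pair N g h" and del: "delete N g = M"
    by (auto simp: parallel_extension_iff)
  have IH: "delete (delete N g) a \<in> SP" "contract (delete N g) a \<in> SP"
    if "a \<in> ground N" "a \<noteq> g" for a
    using SP_parallel.IH[of a] that by (auto simp: del[symmetric])
  have "delete N e \<in> SP"
    using SP_delete_parallel_step[OF N p SP_parallel.prems] SP_parallel.hyps(1) IH(1)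
      SP_parallel.prems del by blast
  moreover from this have "contract N e \<in> SP"
    using SP_contract_parallel_step[OF N p SP_parallel.prems] IH(2) by blast
  ultimately show ?case ..
next
  case (SP_dual M)
  then have M: "matroid M" and e: "e \<in> ground M" by (auto simp: matroid_SP)
  show ?case
    using SP_dual.IH[OF e] by (simp add: contract_dual[OF M] delete_dual[OF M] SP.SP_dual)
qed

text \<open>A last parallel extension supplies a pair in the matroid itself; duality interchanges
  the last two alternatives.\<close>

lemma SP_cases_parallel_pair:
  "M \<in> SP \<Longrightarrow> M \<in> LPM \<or> (\<exists>g h. parallel_pair M g h) \<or> (\<exists>g h. parallel_pair (dual M) g h)"
proof (induction rule: SP.induct)
  case (SP_dual M)
  then show ?case using LPM_dual dual_dual_matroid[OF matroid_SP[OF SP_dual(1)]] by metis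
qed (auto simp: parallel_extension_iff)

section \<open>Base-cobases\<close>

lemma base_cobases_parallel:
  assumes M: "matroid M" and p: "parallel_pair M g h"
  defines "K \<equiv> contract (delete M g) h"
  shows "base_cobases M = insert g ` base_cobases K \<union> insert h ` base_cobases K"
proof -
  note gh = parallel_pair_ground[OF M p] and p' = parallel_pair_sym[OF p]
  have ne: "g \<noteq> h" using p by (simp add: parallel_pair_def)
  have K: "X \<in> bases K \<longleftrightarrow> h \<notin> X \<and> insert h X \<in> bases M" for X
    unfolding K_def by (rule contract_parallel(3)[OF M p])
  \<comment> \<open>Swapping makes the description of \<open>K\<close> symmetric in \<open>g\<close>
    and \<open>h\<close>, although \<open>K\<close> is built by deleting one and contracting the
    other.\<close>
  have K': "X \<in> bases K \<longleftrightarrow> g \<notin> X \<and> insert g X \<in> bases M" for X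
  proof
    assume "X \<in> bases K"
    then have X: "h \<notin> X" "insert h X \<in> bases M" by (auto simp: K)
    then have "g \<notin> X" using parallel_pair_not_both[OF p' X(2)] by auto
    then show "g \<notin> X \<and> insert g X \<in> bases M"
      using parallel_pair_swap[OF M p' X(2)] X(1) by simp
  next
    assume X: "g \<notin> X \<and> insert g X \<in> bases M"
    then have "h \<notin> X" using parallel_pair_not_both[OF p, of "insert g X"] by auto
    then show "X \<in> bases K"
      using parallel_pair_swap[OF M p, of "insert g X"] X by (simp add: K)
  qed
  have gK: "ground K = ground M - {g} - {h}" by (simp add: K_def)
  \<comment> \<open>Of the pair, one element goes to the base and the other to its complement, so
    complements in \<open>M\<close> restrict to complements in \<open>K\<close>.\<close>
  have step: "insert b X \<in> base_cobases M \<longleftrightarrow> X \<in> base_cobases K"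
    if X: "X \<subseteq> ground K" and ab: "(a, b) = (g, h) \<or> (a, b) = (h, g)" for X a b
  proof -
    have "insert b X \<in> bases M \<longleftrightarrow> X \<in> bases K"
      using ab X K K' gK by auto
    moreover have "ground M - insert b X = insert a (ground K - X)"
      using ab X gh ne unfolding gK by auto
    moreover have "insert a (ground K - X) \<in> bases M \<longleftrightarrow> ground K - X \<in> bases K"
      using ab K K' gK by auto
    ultimately show ?thesis by (simp add: base_cobases_def)
  qed
  have "X \<subseteq> ground K" if "X \<in> base_cobases K" for X
    using that matroidD(3)[OF matroid_contract[OF matroid_delete[OF M]]]
    by (auto simp: base_cobases_def K_def)
  then have sup: "insert g ` base_cobases K \<union> insert h ` base_cobases K \<subseteq> base_cobases M"
    using step[of _ h g] step[of _ g h] by (simp add: image_subset_iff)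
  have "B \<in> insert g ` base_cobases K \<union> insert h ` base_cobases K" if B: "B \<in> base_cobases M" for B
  proof -
    have bb: "B \<in> bases M" "ground M - B \<in> bases M" using B by (auto simp: base_cobases_def)
    then have sub: "B \<subseteq> ground M" using matroidD(3)[OF M] by blast
    have "g \<in> B \<longleftrightarrow> h \<notin> B"
      using parallel_pair_not_both[OF p bb(1)] parallel_pair_not_both[OF p bb(2)] gh by auto
    then consider "g \<in> B" "h \<notin> B" | "h \<in> B" "g \<notin> B" by blast
    then show ?thesis
    proof cases
      case 1
      then have eq: "B = insert g (B - {g})" and "B - {g} \<subseteq> ground K" using sub gK by auto
      then have "B - {g} \<in> base_cobases K" using step[of "B - {g}" h g] B by simp
      then show ?thesis using eq by blast
    next
      case 2
      then have eq: "B = insert h (B - {h})" and "B - {h} \<subseteq> ground K" using sub gK by auto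
      then have "B - {h} \<in> base_cobases K" using step[of "B - {h}" g h] B by simp
      then show ?thesis using eq by blast
    qed
  qed
  then show ?thesis using sup by blast
qed

lemma SP_add_parallel_pair:
  assumes K: "K \<in> SP" and gh: "g \<notin> ground K" "h \<notin> ground K" "g \<noteq> h"
  shows "(insert g (insert h (ground K)), insert g ` bases K \<union> insert h ` bases K) \<in> SP"
    (is "?N \<in> SP")
proof -
  note MK = matroid_SP[OF K]
  have sub: "\<And>X. X \<in> bases K \<Longrightarrow> g \<notin> X \<and> h \<notin> X" using matroidD(3)[OF MK] gh by blast
  have N: "matroid ?N"
  proof (rule matroidI)
    fix B B' x
    assume B: "B \<in> bases ?N" "B' \<in> bases ?N" and x: "x \<in> B" "x \<notin> B'"
    obtain X a where X: "X \<in> bases K" "B = insert a X" "a \<in> {g, h}" using B(1) by auto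
    obtain X' b where X': "X' \<in> bases K" "B' = insert b X'" "b \<in> {g, h}" using B(2) by auto
    have notin: "a \<notin> X" "b \<notin> X" "a \<notin> X'" "b \<notin> X'" using sub X X' by auto
    show "\<exists>y. y \<in> B' \<and> y \<notin> B \<and> insert y (B - {x}) \<in> bases ?N"
    proof (cases "x = a")
      \<comment> \<open>Here \<open>a\<close> is missing from \<open>B'\<close>, so \<open>b\<close>
        is the other element of the pair and replaces it.\<close>
      case True
      then have "insert b (B - {x}) = insert b X" "b \<in> B'" "b \<notin> B"
        using X X' x notin by auto
      moreover have "insert b X \<in> bases ?N" using X X' by auto
      ultimately show ?thesis by metis
    next
      \<comment> \<open>The exchange takes place inside \<open>K\<close>, and \<open>a\<close> stays
        in the base.\<close>
      case False
      then have "x \<in> X" "x \<notin> X'" using X X' x by auto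
      then obtain y where y: "y \<in> X'" "y \<notin> X" "insert y (X - {x}) \<in> bases K"
        using matroidD(4)[OF MK X(1) X'(1)] by metis
      have "y \<noteq> a" using y notin by auto
      moreover have "insert y (B - {x}) = insert a (insert y (X - {x}))" using False X by auto
      moreover have "insert a (insert y (X - {x})) \<in> bases ?N" using y X by auto
      ultimately show ?thesis using y X X' by (metis insert_iff)
    qed
  qed (use matroidD(1-3)[OF MK] in auto)
  obtain X where X: "X \<in> bases K" using matroidD(2)[OF MK] by blast
  have "parallel_pair ?N g h"
    using X sub gh(3) by (auto simp: parallel_pair_def indep_def)
  moreover have "delete ?N g = add_coloop h K"
    using bases_delete[OF N, of "insert h X" g] X sub gh by (auto simp: prod_eq_iff)
  ultimately have "parallel_extension ?N (add_coloop h K)"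
    using N parallel_extension_iff by blast
  then show ?thesis
    using SP_add_loop_coloop[OF K gh(2)] SP_parallel by blast
qed

lemma SP_base_cobases:
  "M \<in> SP \<Longrightarrow> base_cobases M \<noteq> {} \<Longrightarrow> (ground M, base_cobases M) \<in> SP"
proof (induction "card (ground M)" arbitrary: M rule: less_induct)
  case less
  \<comment> \<open>Stated for any \<open>N\<close> on the ground set of \<open>M\<close>, so that
    it serves both \<open>M\<close> and its dual, which have the same base-cobases.\<close>
  have step: "(ground N, base_cobases N) \<in> SP"
    if N: "N \<in> SP" "ground N = ground M" "base_cobases N \<noteq> {}" and p: "parallel_pair N g h"
    for N g h
  proof -
    let ?K = "contract (delete N g) h"
    note MN = matroid_SP[OF N(1)]
    note gh = parallel_pair_ground[OF MN p]
    have ne: "g \<noteq> h" using p by (simp add: parallel_pair_def)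
    have bc: "base_cobases N = insert g ` base_cobases ?K \<union> insert h ` base_cobases ?K"
      by (rule base_cobases_parallel[OF MN p])
    have "?K \<in> SP" using SP_minors[OF N(1) gh(1)] SP_minors[of "delete N g" h] gh ne by simp
    moreover have "ground ?K = ground M - {g} - {h}" "g \<in> ground M" using gh N(2) by simp_all
    then have "ground ?K \<subset> ground M" by auto
    then have "card (ground ?K) < card (ground M)"
      using matroidD(1)[OF MN] N(2) psubset_card_mono by metis
    moreover have "base_cobases ?K \<noteq> {}" using bc N(3) by auto
    ultimately have "(ground ?K, base_cobases ?K) \<in> SP" by (intro less.hyps)
    from SP_add_parallel_pair[OF this, of g h] show ?thesis
      using gh ne by (simp add: bc insert_absorb)
  qed
  note M = matroid_SP[OF less.prems(1)]
  consider "M \<in> LPM" | g h where "parallel_pair M g h" | g h where "parallel_pair (dual M) g h"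
    using SP_cases_parallel_pair[OF less.prems(1)] by blast
  then show ?case
  proof cases
    case 1
    then show ?thesis using LPM_base_cobases less.prems(2) SP_LPM by blast
  next
    case 2
    then show ?thesis using step less.prems by blast
  next
    case 3
    then show ?thesis
      using step[of "dual M"] less.prems SP_dual base_cobases_dual[OF M] by (metis ground_dual)
  qed
qed

text \<open>Adjacency depends only on the two vertices, and an edge lies in \<open>W\<close> exactly
  when both of its ends do.\<close>

lemma induced_subgraph_base_graph:
  assumes "W \<subseteq> bases M"
  shows "induced_subgraph (base_graph M) W = base_graph (ground M, W)"
proof -
  have "{e \<in> {{B, B'} | B B'. B \<in> V \<and> B' \<in> V \<and> R B B'}. e \<subseteq> W} =
      {{B, B'} | B B'. B \<in> W \<and> B' \<in> W \<and> R B B'}" if "W \<subseteq> V" for V and R :: "'a set \<Rightarrow> 'a set \<Rightarrow> bool"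
  proof (intro subset_antisym subsetI)
    fix e assume "e \<in> {e \<in> {{B, B'} | B B'. B \<in> V \<and> B' \<in> V \<and> R B B'}. e \<subseteq> W}"
    then obtain B B' where "e = {B, B'}" "R B B'" "e \<subseteq> W" by blast
    moreover from this have "B \<in> W" "B' \<in> W" by auto
    ultimately show "e \<in> {{B, B'} | B B'. B \<in> W \<and> B' \<in> W \<and> R B B'}" by blast
  next
    fix e assume "e \<in> {{B, B'} | B B'. B \<in> W \<and> B' \<in> W \<and> R B B'}"
    then obtain B B' where e: "e = {B, B'}" "R B B'" "B \<in> W" "B' \<in> W" by blast
    then have "B \<in> V" "B' \<in> V" "e \<subseteq> W" using that by auto
    with e show "e \<in> {e \<in> {{B, B'} | B B'. B \<in> V \<and> B' \<in> V \<and> R B B'}. e \<subseteq> W}" by blast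
  qed
  from this[OF assms, of "\<lambda>B B'. card (sym_diff B B') = 2"] assms show ?thesis
    by (simp add: base_graph_def induced_subgraph_def Int_absorb1)
qed

theorem theorem3p6:
  fixes M :: "'a matroid"
  assumes "block_matroid M"
    and "M \<in> spex LPM"
  shows "\<exists>N :: 'a matroid. matroid N \<and> ground N = ground M \<and> N \<in> spex LPM \<and>
           bases N = base_cobases M \<and> base_cobase_graph M = base_graph N"
proof (intro exI conjI)
  let ?N = "(ground M, base_cobases M)"
  have SP: "?N \<in> SP"
    using SP_base_cobases[OF spex_LPM_subset_SP[OF assms(2)]] assms(1)
    by (simp add: block_matroid_def)
  then show "matroid ?N" by (rule matroid_SP)
  show "?N \<in> spex LPM" using SP_subset_spex_LPM[OF SP] by blast
  have "base_cobases M \<subseteq> bases M" by (auto simp: base_cobases_def)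
  then show "base_cobase_graph M = base_graph ?N"
    by (simp add: base_cobase_graph_def induced_subgraph_base_graph)
qed simp_all

end
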